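(* Let $m\ge 1$, let $Z$ be a commutative ring with one, let $q\in Z$, let $W=\mathsf{Sym}_{m+1}$ and let $H=H(A_m)$ be the Iwahori–Hecke algebra of $W$ over $Z$ with parameter $q$. Put $M=(m+1)!=|W|$. (a) The cost of multiplying two elements of $H$, each represented as a simple coefficient list over $Z$, using the simple coefficient list algorithm (described in the context), is at most $\frac{m^2+m+4}{2}M^2$ operations in $Z$. (b) The cost of multiplying two elements of $H$, each represented as a nested coefficient list over $H(A_{m-1})$, is at most $(1+e)M^2$ operations in $Z$, where $e=\exp(1)$; that is, the nested coefficient list of the product can be computed from the nested coefficient lists of the factors with at most $(1+e)M^2$ operations in $Z$.
   Context: The Coxeter group $W(A_m)$ is $\mathsf{Sym}_{m+1}$ acting on $\{1,\dots,m+1\}$ with generators $S=\{s_1,\dots,s_m\}$, $s_i=(i,i+1)$; permutations are multiplied from left to right; $\ell(w)$ is the minimal number of factors in an expression of $w$ as a product of elements of $S$. $W(A_0)$ is trivial, and $W(A_{m-1})$ is the subgroup of $W(A_m)$ generated by $s_1,\dots,s_{m-1}$. The Iwahori–Hecke algebra $H(A_m)$ is the free $Z$-module with basis $\{T_w: w\in W(A_m)\}$, with the associative unital $Z$-algebra structure (identity $T_1$) determined by, for $w\in W(A_m)$, $s\in S$: $T_wT_s=T_{ws}$ if $\ell(ws)>\ell(w)$, and $T_wT_s=(q-1)T_w+qT_{ws}$ if $\ell(ws)<\ell(w)$. $H(A_{m-1})$ is the subalgebra of $H(A_m)$ spanned by $T_w$, $w\in W(A_{m-1})$, and $H(A_0)=Z$.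 Put $a(m,0)=1$ and $a(m,k)=s_ms_{m-1}\cdots s_{m-k+1}$ for $1\le k\le m$. Every $h\in H(A_m)$ is uniquely of the form $h=\sum_{k=0}^m h_kT_{a(m,k)}$ with $h_k\in H(A_{m-1})$. The nested coefficient list of $h$ over $H(A_{m-1})$ is $(h_0,\dots,h_m)$, where each $h_k$ is itself recursively represented as a nested coefficient list over $H(A_{m-2})$, and so on, down to $H(A_0)=Z$; in total $M$ scalars. The simple coefficient list of $h=\sum_{w\in W}z_wT_w$ is $(z_w)_{w\in W}$. Cost: the cost of a computation is the number of additions (or subtractions) and multiplications in $Z$ performed, each costing $1$ unit; the coefficients of the given elements are treated as arbitrary inputs (worst case), and the constants $q$ and $q-1$ are available for free. Simple coefficient list algorithm: for $s\in S$ put $(z_w)_{w\in W}\star T_s=(z'_w)_{w\in W}$ where $z'_w=q z_{ws}$ if $\ell(ws)>\ell(w)$ and $z'_w=z_{ws}+(q-1)z_w$ if $\ell(ws)<\ell(w)$. For $v\in W$ with chosen reduced expression $v=r_1\cdots r_l$ ($r_i\in S$, $l=\ell(v)$) put $(z_w)\star T_v=(\cdots(((z_w)\star T_{r_1})\star T_{r_2})\star\cdots)\star T_{r_l}$. Given $h=\sum_w z_wT_w$ and $h'=\sum_v b_vT_v$, the coefficient list of $hh'$ is computed as $\sum_{v\in W} b_v(z_w)_{w\in W}\star T_v$: for each $v$ separately, the list $(z_w)$ is scaled by $b_v$ and $\star T_v$ is applied by successive application of $\star T_{r_i}$, and then the resulting lists are added as vectors. *)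

theory Defs
  imports Complex_Main "HOL-Combinatorics.Permutations"
begin

section \<open>The Coxeter group of type A\<close>

definition cox_group :: "nat \<Rightarrow> (nat \<Rightarrow> nat) set" where
  "cox_group m = {w. w permutes {1..m+1}}"

text \<open>Permutations are multiplied from left to right. Since \<open>permutes\<close> makes a permutation the identity
  outside its carrier, \<open>cox_group (m - 1)\<close> is literally a subset of \<open>cox_group m\<close>.\<close>

definition pmult :: "(nat \<Rightarrow> nat) \<Rightarrow> (nat \<Rightarrow> nat) \<Rightarrow> nat \<Rightarrow> nat"  (infixl "\<cdot>" 70) where
  "u \<cdot> v = v \<circ> u"

definition cox_gen :: "nat \<Rightarrow> nat \<Rightarrow> nat" where
  "cox_gen i = transpose i (i + 1)"

definition cox_word :: "nat list \<Rightarrow> nat \<Rightarrow> nat" where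
  "cox_word is = foldl (\<lambda>w i. w \<cdot> cox_gen i) id is"

definition cox_length :: "nat \<Rightarrow> (nat \<Rightarrow> nat) \<Rightarrow> nat" where
  "cox_length m w = (LEAST n. \<exists>is. set is \<subseteq> {1..m} \<and> cox_word is = w \<and> length is = n)"

definition reduced_word :: "nat \<Rightarrow> (nat \<Rightarrow> nat) \<Rightarrow> nat list \<Rightarrow> bool" where
  "reduced_word m w is \<longleftrightarrow>
     set is \<subseteq> {1..m} \<and> cox_word is = w \<and> length is = cox_length m w"

text \<open>\<open>coset_rep m k\<close> is the product \<open>s\<^sub>m s\<^sub>m\<^sub>-\<^sub>1 \<dots> s\<^sub>m\<^sub>-\<^sub>k\<^sub>+\<^sub>1\<close> of \<open>k\<close> factors.\<close>

definition coset_rep :: "nat \<Rightarrow> nat \<Rightarrow> nat \<Rightarrow> nat" where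
  "coset_rep m k = cox_word (map (\<lambda>j. m - j) [0..<k])"


section \<open>The Iwahori--Hecke algebra\<close>

text \<open>The free module on the symbols \<open>T\<^sub>w\<close> is the set of coefficient functions supported on the group; such a
  function is the simple coefficient list of the element. The sort \<open>{comm_ring, monoid_mult}\<close> is that
  of commutative rings with one; \<open>comm_ring_1\<close> would in addition exclude the zero ring.\<close>

definition hecke_elts :: "nat \<Rightarrow> ((nat \<Rightarrow> nat) \<Rightarrow> 'z::{comm_ring,monoid_mult}) set" where
  "hecke_elts m = {h. \<forall>w. w \<notin> cox_group m \<longrightarrow> h w = 0}"

definition hecke_T :: "(nat \<Rightarrow> nat) \<Rightarrow> (nat \<Rightarrow> nat) \<Rightarrow> 'z::{comm_ring,monoid_mult}" where
  "hecke_T w = (\<lambda>u. if u = w then 1 else 0)"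

text \<open>The associative unital algebra structure is characterised (uniquely, on \<open>hecke_elts m\<close>) by the
  following axioms for its multiplication.\<close>

locale hecke_algebra =
  fixes m :: nat
    and q :: "'z::{comm_ring,monoid_mult}"
    and mul :: "((nat \<Rightarrow> nat) \<Rightarrow> 'z) \<Rightarrow> ((nat \<Rightarrow> nat) \<Rightarrow> 'z) \<Rightarrow> ((nat \<Rightarrow> nat) \<Rightarrow> 'z)"
  assumes mul_closed:
      "\<lbrakk>g \<in> hecke_elts m; h \<in> hecke_elts m\<rbrakk> \<Longrightarrow> mul g h \<in> hecke_elts m"
    and mul_add_left:
      "\<lbrakk>f \<in> hecke_elts m; g \<in> hecke_elts m; h \<in> hecke_elts m\<rbrakk>
        \<Longrightarrow> mul (\<lambda>w. f w + g w) h = (\<lambda>w. mul f h w + mul g h w)"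
    and mul_add_right:
      "\<lbrakk>f \<in> hecke_elts m; g \<in> hecke_elts m; h \<in> hecke_elts m\<rbrakk>
        \<Longrightarrow> mul f (\<lambda>w. g w + h w) = (\<lambda>w. mul f g w + mul f h w)"
    and mul_scale_left:
      "\<lbrakk>g \<in> hecke_elts m; h \<in> hecke_elts m\<rbrakk>
        \<Longrightarrow> mul (\<lambda>w. c * g w) h = (\<lambda>w. c * mul g h w)"
    and mul_scale_right:
      "\<lbrakk>g \<in> hecke_elts m; h \<in> hecke_elts m\<rbrakk>
        \<Longrightarrow> mul g (\<lambda>w. c * h w) = (\<lambda>w. c * mul g h w)"
    and mul_assoc:
      "\<lbrakk>f \<in> hecke_elts m; g \<in> hecke_elts m; h \<in> hecke_elts m\<rbrakk>
        \<Longrightarrow> mul (mul f g) h = mul f (mul g h)"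
    and mul_one_left: "h \<in> hecke_elts m \<Longrightarrow> mul (hecke_T id) h = h"
    and mul_one_right: "h \<in> hecke_elts m \<Longrightarrow> mul h (hecke_T id) = h"
    and mul_T_up:
      "\<lbrakk>w \<in> cox_group m; i \<in> {1..m}; cox_length m (w \<cdot> cox_gen i) > cox_length m w\<rbrakk>
        \<Longrightarrow> mul (hecke_T w) (hecke_T (cox_gen i)) = hecke_T (w \<cdot> cox_gen i)"
    and mul_T_down:
      "\<lbrakk>w \<in> cox_group m; i \<in> {1..m}; cox_length m (w \<cdot> cox_gen i) < cox_length m w\<rbrakk>
        \<Longrightarrow> mul (hecke_T w) (hecke_T (cox_gen i))
           = (\<lambda>u. (q - 1) * hecke_T w u + q * hecke_T (w \<cdot> cox_gen i) u)"


section \<open>Nested coefficient lists\<close>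

datatype 'z nested = Scalar 'z | Coeffs "'z nested list"

text \<open>\<open>nested_list mul n h t\<close>: the tree \<open>t\<close> is the nested coefficient list of the element \<open>h\<close> of the
  subalgebra \<open>H(A\<^sub>n)\<close> of \<open>H(A\<^sub>m)\<close>, where \<open>mul\<close> is the multiplication of \<open>H(A\<^sub>m)\<close> and \<open>n \<le> m\<close>.\<close>

fun nested_list ::
  "(((nat \<Rightarrow> nat) \<Rightarrow> 'z) \<Rightarrow> ((nat \<Rightarrow> nat) \<Rightarrow> 'z) \<Rightarrow> ((nat \<Rightarrow> nat) \<Rightarrow> 'z)) \<Rightarrow> nat
    \<Rightarrow> ((nat \<Rightarrow> nat) \<Rightarrow> 'z::{comm_ring,monoid_mult}) \<Rightarrow> 'z nested \<Rightarrow> bool" where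
  "nested_list mul 0 h t \<longleftrightarrow> (\<exists>z. t = Scalar z \<and> h = (\<lambda>w. z * hecke_T id w))"
| "nested_list mul (Suc n) h t \<longleftrightarrow>
     (\<exists>hs ts. t = Coeffs ts \<and> length ts = n + 2 \<and>
        (\<forall>k \<le> Suc n. hs k \<in> hecke_elts n \<and> nested_list mul n (hs k) (ts ! k)) \<and>
        h = (\<lambda>w. \<Sum>k\<le>Suc n. mul (hs k) (hecke_T (coset_rep (Suc n) k)) w))"

fun scalars :: "'z nested \<Rightarrow> 'z list" where
  "scalars (Scalar z) = [z]"
| "scalars (Coeffs ts) = concat (map scalars ts)"


section \<open>Counting ring operations\<close>

text \<open>A computation returns a value together with the number of ring operations performed.\<close>

type_synonym 'a counted = "'a \<times> nat"

definition c_return :: "'a \<Rightarrow> 'a counted" where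
  "c_return x = (x, 0)"

definition c_bind :: "'a counted \<Rightarrow> ('a \<Rightarrow> 'b counted) \<Rightarrow> 'b counted" where
  "c_bind c f = (fst (f (fst c)), snd c + snd (f (fst c)))"

definition c_add :: "'z::plus \<Rightarrow> 'z \<Rightarrow> 'z counted" where
  "c_add x y = (x + y, 1)"

definition c_sub :: "'z::minus \<Rightarrow> 'z \<Rightarrow> 'z counted" where
  "c_sub x y = (x - y, 1)"

definition c_mul :: "'z::times \<Rightarrow> 'z \<Rightarrow> 'z counted" where
  "c_mul x y = (x * y, 1)"

text \<open>Compute one entry for each group element; the order does not affect the total cost.\<close>

definition c_list :: "nat \<Rightarrow> ((nat \<Rightarrow> nat) \<Rightarrow> 'z::zero counted) \<Rightarrow> ((nat \<Rightarrow> nat) \<Rightarrow> 'z) counted" where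
  "c_list m f = (\<lambda>w. if w \<in> cox_group m then fst (f w) else 0, \<Sum>w\<in>cox_group m. snd (f w))"


section \<open>The simple coefficient list algorithm\<close>

definition simple_step ::
  "nat \<Rightarrow> 'z::{comm_ring,monoid_mult} \<Rightarrow> ((nat \<Rightarrow> nat) \<Rightarrow> 'z) \<Rightarrow> nat \<Rightarrow> ((nat \<Rightarrow> nat) \<Rightarrow> 'z) counted" where
  "simple_step m q z i =
     c_list m (\<lambda>w. if cox_length m (w \<cdot> cox_gen i) > cox_length m w
       then c_mul q (z (w \<cdot> cox_gen i))
       else c_bind (c_mul (q - 1) (z w)) (\<lambda>y. c_add (z (w \<cdot> cox_gen i)) y))"

fun simple_word ::
  "nat \<Rightarrow> 'z::{comm_ring,monoid_mult} \<Rightarrow> ((nat \<Rightarrow> nat) \<Rightarrow> 'z) \<Rightarrow> nat list \<Rightarrow> ((nat \<Rightarrow> nat) \<Rightarrow> 'z) counted" where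
  "simple_word m q z [] = c_return z"
| "simple_word m q z (i # is) = c_bind (simple_step m q z i) (\<lambda>z'. simple_word m q z' is)"

definition simple_term ::
  "nat \<Rightarrow> 'z::{comm_ring,monoid_mult} \<Rightarrow> ((nat \<Rightarrow> nat) \<Rightarrow> 'z) \<Rightarrow> 'z \<Rightarrow> nat list
    \<Rightarrow> ((nat \<Rightarrow> nat) \<Rightarrow> 'z) counted" where
  "simple_term m q z c is =
     c_bind (c_list m (\<lambda>w. c_mul c (z w))) (\<lambda>z'. simple_word m q z' is)"

text \<open>The argument \<open>red\<close> gives the chosen reduced expressions, and the list of group elements the order in which the terms are
  added; \<open>n\<close> terms need \<open>n - 1\<close> vector additions.\<close>

fun simple_sum ::
  "nat \<Rightarrow> 'z::{comm_ring,monoid_mult} \<Rightarrow> ((nat \<Rightarrow> nat) \<Rightarrow> nat list) \<Rightarrow> ((nat \<Rightarrow> nat) \<Rightarrow> 'z)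
    \<Rightarrow> ((nat \<Rightarrow> nat) \<Rightarrow> 'z) \<Rightarrow> (nat \<Rightarrow> nat) list \<Rightarrow> ((nat \<Rightarrow> nat) \<Rightarrow> 'z) counted" where
  "simple_sum m q red z b [] = c_return (\<lambda>w. 0)"
| "simple_sum m q red z b [v] = simple_term m q z (b v) (red v)"
| "simple_sum m q red z b (v # v' # vs) =
     c_bind (simple_term m q z (b v) (red v)) (\<lambda>x.
     c_bind (simple_sum m q red z b (v' # vs)) (\<lambda>y.
     c_list m (\<lambda>w. c_add (x w) (y w))))"


section \<open>Arbitrary computations from given scalars\<close>

text \<open>A computation in the ring whose cost is meant for arbitrary inputs is a straight-line program: a fixed sequence of
  additions, subtractions and multiplications whose operands are inputs, earlier results, or the
  free constants \<open>q\<close> and \<open>q - 1\<close>; its outputs are again such operands.\<close>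

datatype operand = Input nat | Result nat | Const_q | Const_q_minus_1

datatype instr = Add operand operand | Sub operand operand | Mul operand operand

type_synonym slp = "instr list \<times> operand list"

fun operand_ok :: "nat \<Rightarrow> nat \<Rightarrow> operand \<Rightarrow> bool" where
  "operand_ok n j (Input i) \<longleftrightarrow> i < n"
| "operand_ok n j (Result i) \<longleftrightarrow> i < j"
| "operand_ok n j Const_q \<longleftrightarrow> True"
| "operand_ok n j Const_q_minus_1 \<longleftrightarrow> True"

fun instr_ok :: "nat \<Rightarrow> nat \<Rightarrow> instr \<Rightarrow> bool" where
  "instr_ok n j (Add a b) \<longleftrightarrow> operand_ok n j a \<and> operand_ok n j b"
| "instr_ok n j (Sub a b) \<longleftrightarrow> operand_ok n j a \<and> operand_ok n j b"
| "instr_ok n j (Mul a b) \<longleftrightarrow> operand_ok n j a \<and> operand_ok n j b"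

definition slp_ok :: "nat \<Rightarrow> slp \<Rightarrow> bool" where
  "slp_ok n P \<longleftrightarrow>
     (\<forall>j < length (fst P). instr_ok n j (fst P ! j)) \<and>
     (\<forall>a \<in> set (snd P). operand_ok n (length (fst P)) a)"

fun operand_val :: "'z::{comm_ring,monoid_mult} \<Rightarrow> 'z list \<Rightarrow> 'z list \<Rightarrow> operand \<Rightarrow> 'z" where
  "operand_val q xs rs (Input i) = xs ! i"
| "operand_val q xs rs (Result i) = rs ! i"
| "operand_val q xs rs Const_q = q"
| "operand_val q xs rs Const_q_minus_1 = q - 1"

fun instr_val :: "'z::{comm_ring,monoid_mult} \<Rightarrow> 'z list \<Rightarrow> 'z list \<Rightarrow> instr \<Rightarrow> 'z counted" where
  "instr_val q xs rs (Add a b) = c_add (operand_val q xs rs a) (operand_val q xs rs b)"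
| "instr_val q xs rs (Sub a b) = c_sub (operand_val q xs rs a) (operand_val q xs rs b)"
| "instr_val q xs rs (Mul a b) = c_mul (operand_val q xs rs a) (operand_val q xs rs b)"

fun instrs_val :: "'z::{comm_ring,monoid_mult} \<Rightarrow> 'z list \<Rightarrow> 'z list \<Rightarrow> instr list \<Rightarrow> 'z list counted" where
  "instrs_val q xs rs [] = c_return rs"
| "instrs_val q xs rs (c # cs) =
     c_bind (instr_val q xs rs c) (\<lambda>r. instrs_val q xs (rs @ [r]) cs)"

definition slp_val :: "'z::{comm_ring,monoid_mult} \<Rightarrow> slp \<Rightarrow> 'z list \<Rightarrow> 'z list counted" where
  "slp_val q P xs =
     c_bind (instrs_val q xs [] (fst P)) (\<lambda>rs. c_return (map (operand_val q xs rs) (snd P)))"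

end

theory Submission
  imports Defs
begin

text \<open>The number of inversions computes the length in the symmetric group, so lengths add in
  \<open>w = u a(n, k)\<close> with \<open>u \<in> W(A\<^sub>n\<^sub>-\<^sub>1)\<close>. Summing over this decomposition gives the average length
  \<open>m (m + 1) / 4\<close>, which is (a), because \<open>\<star> T\<^sub>s\<close> costs at most 2 operations per entry. It also gives
  \<open>T\<^sub>u T\<^bsub>a(n, k)\<^esub> = T\<^bsub>u a(n, k)\<^esub>\<close>, so a nested coefficient list is just the simple coefficient list in
  a particular order and (b) may be proved with any algorithm on simple lists. Compute all the
  products \<open>h T\<^sub>v\<close> in order of increasing length, each from a shorter one by a single \<open>\<star> T\<^sub>s\<close>. Since only
  half of the entries of \<open>\<star> T\<^sub>s\<close> need 2 operations, this costs \<open>3/2 M\<close> for each \<open>v\<close>. Scaling by the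
  coefficients of \<open>h'\<close> and adding up cost \<open>M\<close> for each \<open>v\<close>, in total \<open>7/2 M\<^sup>2 \<le> (1 + e) M\<^sup>2\<close>.\<close>

section \<open>Length and coset decomposition in the symmetric group\<close>

lemma cox_gen_permutes: "i \<in> {1..m} \<Longrightarrow> cox_gen i permutes {1..m+1}"
  unfolding cox_gen_def by (rule permutes_swap_id) auto

lemma cox_gen_in_cox_group: "i \<in> {1..m} \<Longrightarrow> cox_gen i \<in> cox_group m"
  using cox_gen_permutes by (simp add: cox_group_def)

lemma id_in_cox_group: "id \<in> cox_group m"
  by (simp add: cox_group_def permutes_id)

lemma pmult_in_cox_group: "u \<in> cox_group m \<Longrightarrow> v \<in> cox_group m \<Longrightarrow> u \<cdot> v \<in> cox_group m"
  by (simp add: cox_group_def pmult_def permutes_compose)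

lemma cox_group_mono: "n \<le> m \<Longrightarrow> cox_group n \<subseteq> cox_group m"
  unfolding cox_group_def by (auto intro: permutes_subset)

lemma finite_cox_group: "finite (cox_group m)"
  by (simp add: cox_group_def finite_permutations)

lemma card_cox_group: "card (cox_group m) = fact (m + 1)"
  unfolding cox_group_def by (rule card_permutations) simp_all

lemma pmult_cox_gen_cancel: "w \<cdot> cox_gen i \<cdot> cox_gen i = w"
  by (simp add: pmult_def cox_gen_def fun_eq_iff)

lemma eq_pmult_cox_gen_iff: "w = u \<cdot> cox_gen i \<longleftrightarrow> u = w \<cdot> cox_gen i"
  using pmult_cox_gen_cancel by metis

lemma pmult_assoc: "u \<cdot> v \<cdot> w = u \<cdot> (v \<cdot> w)"
  by (simp add: pmult_def comp_assoc)

lemma inv_pmult_cox_gen: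
  assumes "w \<in> cox_group m"
  shows "inv (w \<cdot> cox_gen i) = inv w \<circ> cox_gen i"
proof -
  have "bij w" using assms by (auto simp: cox_group_def permutes_bij)
  then show ?thesis
    by (simp add: pmult_def cox_gen_def o_inv_distrib bij_swap_iff)
qed

lemma cox_word_Nil: "cox_word [] = id"
  by (simp add: cox_word_def)

lemma cox_word_snoc: "cox_word (is @ [i]) = cox_word is \<cdot> cox_gen i"
  by (simp add: cox_word_def)

lemma cox_word_in_cox_group: "set is \<subseteq> {1..m} \<Longrightarrow> cox_word is \<in> cox_group m"
proof (induction "is" rule: rev_induct)
  case Nil
  show ?case by (simp only: cox_word_Nil id_in_cox_group)
next
  case (snoc i "is")
  then show ?case by (simp add: cox_word_snoc pmult_in_cox_group cox_gen_in_cox_group)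
qed

section \<open>Inversions and the length function\<close>

definition inversions :: "nat \<Rightarrow> (nat \<Rightarrow> nat) \<Rightarrow> (nat \<times> nat) set" where
  "inversions m p = {(a, b). 1 \<le> a \<and> a < b \<and> b \<le> m + 1 \<and> p a > p b}"

lemma finite_inversions: "finite (inversions m p)"
  by (rule finite_subset[of _ "{1..m+1} \<times> {1..m+1}"]) (auto simp: inversions_def)

lemma cox_gen_less_iff:
  assumes "a < b" "(a, b) \<noteq> (i, i + 1)"
  shows "cox_gen i a < cox_gen i b"
  using assms by (auto simp: cox_gen_def transpose_def)

text \<open>\<open>cox_gen i\<close> keeps the order of every pair \<open>a < b\<close> other than
  \<open>(i, i + 1)\<close>, so applying it to both components carries inversions to inversions; it
  is an involution and hence its own inverse.\<close>

lemma inversions_pair_bij: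
  assumes "i \<in> {1..m}"
  shows "bij_betw (\<lambda>(a, b). (cox_gen i a, cox_gen i b))
    (inversions m (p \<circ> cox_gen i) - {(i, i + 1)}) (inversions m p - {(i, i + 1)})"
    (is "bij_betw ?f ?A ?B")
proof -
  have invol: "cox_gen i (cox_gen i a) = a" for a by (simp add: cox_gen_def)
  have range: "1 \<le> cox_gen i a \<and> cox_gen i a \<le> m + 1" if "1 \<le> a" "a \<le> m + 1" for a
    using permutes_in_image[OF cox_gen_permutes[OF assms], of a] that by simp
  have pair: "(cox_gen i a, cox_gen i b) \<noteq> (i, i + 1)" if "a < b" for a b
    using that by (auto simp: cox_gen_def transpose_def split: if_splits)
  \<comment> \<open>Shown for arbitrary \<open>r\<close>: the choice \<open>p\<close> gives one
    inclusion, and \<open>p \<circ> cox_gen i\<close> gives the other.\<close>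
  have map: "?f ` (inversions m (r \<circ> cox_gen i) - {(i, i + 1)}) \<subseteq> inversions m r - {(i, i + 1)}" for r
  proof (rule image_subsetI)
    fix x assume "x \<in> inversions m (r \<circ> cox_gen i) - {(i, i + 1)}"
    moreover obtain a b where x: "x = (a, b)" by (cases x)
    ultimately have "1 \<le> a" "a < b" "b \<le> m + 1" "r (cox_gen i a) > r (cox_gen i b)"
      "(a, b) \<noteq> (i, i + 1)"
      by (auto simp: inversions_def)
    then show "?f x \<in> inversions m r - {(i, i + 1)}"
      using cox_gen_less_iff[of a b i] pair[of a b] range[of a] range[of b] x
      by (auto simp: inversions_def)
  qed
  have "p \<circ> cox_gen i \<circ> cox_gen i = p" by (simp add: fun_eq_iff invol)
  then have "?f ` ?B \<subseteq> ?A" using map[of "p \<circ> cox_gen i"] by simp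
  then show ?thesis
    by (intro bij_betw_byWitness[where f' = ?f]) (use map[of p] in \<open>auto simp: invol\<close>)
qed

text \<open>The bijection matches all inversions other than \<open>(i, i + 1)\<close>; this pair is
  an inversion after the swap but not before it.\<close>

lemma card_inversions_cox_gen:
  assumes "i \<in> {1..m}" "p i < p (i + 1)"
  shows "card (inversions m (p \<circ> cox_gen i)) = card (inversions m p) + 1"
proof -
  have "(i, i + 1) \<notin> inversions m p" "(i, i + 1) \<in> inversions m (p \<circ> cox_gen i)"
    using assms by (auto simp: inversions_def cox_gen_def)
  moreover have "card (inversions m (p \<circ> cox_gen i) - {(i, i + 1)}) = card (inversions m p - {(i, i + 1)})"
    using inversions_pair_bij[OF assms(1)] by (rule bij_betw_same_card)
  ultimately show ?thesis
    using card_Suc_Diff1[OF finite_inversions, of "(i, i + 1)" m "p \<circ> cox_gen i"] by simp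
qed

text \<open>The inverse appears because products are read from left to right: passing from
  \<open>w\<close> to \<open>w \<cdot> cox_gen i\<close> exchanges two neighbouring positions of
  \<open>inv w\<close>, but two values of \<open>w\<close>.\<close>

definition inv_number :: "nat \<Rightarrow> (nat \<Rightarrow> nat) \<Rightarrow> nat" where
  "inv_number m w = card (inversions m (inv w))"

lemma inv_number_id: "inv_number m id = 0"
proof -
  have "inversions m id = {}" by (auto simp: inversions_def)
  then show ?thesis by (simp only: inv_number_def inv_id card.empty)
qed

lemma inv_number_ascent:
  assumes "w \<in> cox_group m" "i \<in> {1..m}" "inv w i < inv w (i + 1)"
  shows "inv_number m (w \<cdot> cox_gen i) = inv_number m w + 1"
  using assms card_inversions_cox_gen by (simp add: inv_number_def inv_pmult_cox_gen)

lemma inv_number_descent: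
  assumes "w \<in> cox_group m" "i \<in> {1..m}" "inv w i > inv w (i + 1)"
  shows "inv_number m w = inv_number m (w \<cdot> cox_gen i) + 1"
proof -
  \<comment> \<open>The swap turns the descent into an ascent, so the ascent rule applies to
    \<open>w \<cdot> cox_gen i\<close>, and a second swap restores \<open>w\<close>.\<close>
  have "inv (w \<cdot> cox_gen i) i < inv (w \<cdot> cox_gen i) (i + 1)"
    using assms by (simp add: inv_pmult_cox_gen) (simp add: cox_gen_def)
  then show ?thesis
    using inv_number_ascent[of "w \<cdot> cox_gen i" m i] assms
    by (simp add: pmult_in_cox_group cox_gen_in_cox_group pmult_cox_gen_cancel)
qed

lemma inv_neq_succ: "w \<in> cox_group m \<Longrightarrow> inv w i \<noteq> inv w (i + 1)"
  using permutes_inj[OF permutes_inv, of w "{1..m+1}"] by (simp add: cox_group_def inj_eq)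

text \<open>A further generator raises the inversion number by at most 1, starting from 0 at the
  identity. This is the lower bound for the length.\<close>

lemma inv_number_cox_word_le: "set is \<subseteq> {1..m} \<Longrightarrow> inv_number m (cox_word is) \<le> length is"
proof (induction "is" rule: rev_induct)
  case Nil
  show ?case by (simp only: cox_word_Nil inv_number_id)
next
  case (snoc i "is")
  then have *: "cox_word is \<in> cox_group m" "i \<in> {1..m}" "inv_number m (cox_word is) \<le> length is"
    using cox_word_in_cox_group by auto
  then have "inv_number m (cox_word is \<cdot> cox_gen i) \<le> inv_number m (cox_word is) + 1"
    using inv_number_ascent[OF *(1,2)] inv_number_descent[OF *(1,2)] inv_neq_succ[OF *(1), of i]
    by linarith
  then show ?case using *(3) by (simp add: cox_word_snoc)
qed

text \<open>Without descents \<open>inv w\<close> is strictly increasing on \<open>{1..m+1}\<close>,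
  so \<open>a \<le> inv w a\<close> by induction; a permutation that moves no point down is the
  identity.\<close>

lemma no_descent_imp_id:
  assumes "w \<in> cox_group m" "\<And>i. i \<in> {1..m} \<Longrightarrow> inv w i < inv w (i + 1)"
  shows "w = id"
proof -
  have p: "inv w permutes {1..m+1}" using assms(1) by (simp add: cox_group_def permutes_inv)
  have "a \<le> inv w a" if "1 \<le> a" "a \<le> m + 1" for a
    using that
  proof (induction a rule: dec_induct)
    case base
    then show ?case using permutes_in_image[OF p, of 1] by simp
  next
    case (step a)
    then show ?case using assms(2)[of a] by simp
  qed
  then have "inv w = id" using permutes_natset_ge[OF p] by auto
  moreover have "inv (inv w) = w" using assms(1) by (auto simp: cox_group_def permutes_inv_inv)
  ultimately show ?thesis by (metis inv_id)
qed

text \<open>Sorting by adjacent swaps: each descent that is removed lowers the inversion number by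
  exactly 1, until only the identity is left. This is the upper bound for the length.\<close>

lemma cox_word_of_inv_number:
  "w \<in> cox_group m \<Longrightarrow> \<exists>is. set is \<subseteq> {1..m} \<and> cox_word is = w \<and> length is = inv_number m w"
proof (induction "inv_number m w" arbitrary: w rule: less_induct)
  case less
  show ?case
  proof (cases "\<exists>i\<in>{1..m}. inv w i > inv w (i + 1)")
    case True
    then obtain i where i: "i \<in> {1..m}" "inv w i > inv w (i + 1)" by blast
    note d = inv_number_descent[OF less.prems i]
    have "w \<cdot> cox_gen i \<in> cox_group m"
      using less.prems i by (simp add: pmult_in_cox_group cox_gen_in_cox_group)
    with less.hyps[of "w \<cdot> cox_gen i"] d obtain "is" where
      "set is \<subseteq> {1..m}" "cox_word is = w \<cdot> cox_gen i" "length is = inv_number m (w \<cdot> cox_gen i)"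
      by auto
    then show ?thesis using i d
      by (intro exI[of _ "is @ [i]"]) (auto simp: cox_word_snoc pmult_cox_gen_cancel)
  next
    case False
    then have "w = id"
      using no_descent_imp_id[OF less.prems] inv_neq_succ[OF less.prems] by (meson linorder_neqE_nat)
    then show ?thesis
      by (intro exI[of _ "[]"]) (simp only: cox_word_Nil inv_number_id, simp)
  qed
qed

lemma cox_length_eq_inv_number:
  assumes "w \<in> cox_group m"
  shows "cox_length m w = inv_number m w"
  unfolding cox_length_def
proof (rule Least_equality)
  show "\<exists>is. set is \<subseteq> {1..m} \<and> cox_word is = w \<and> length is = inv_number m w"
    using cox_word_of_inv_number[OF assms] .
qed (use inv_number_cox_word_le in blast)

lemma cox_length_ascent:
  assumes "w \<in> cox_group m" "i \<in> {1..m}" "inv w i < inv w (i + 1)"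
  shows "cox_length m (w \<cdot> cox_gen i) = cox_length m w + 1"
  using assms inv_number_ascent
  by (simp add: cox_length_eq_inv_number pmult_in_cox_group cox_gen_in_cox_group)

lemma cox_length_pmult_cox_gen:
  assumes "w \<in> cox_group m" "i \<in> {1..m}"
  shows "cox_length m (w \<cdot> cox_gen i) = cox_length m w + 1 \<or>
    cox_length m w = cox_length m (w \<cdot> cox_gen i) + 1"
proof -
  have "w \<cdot> cox_gen i \<in> cox_group m"
    using assms by (simp add: pmult_in_cox_group cox_gen_in_cox_group)
  moreover have "inv_number m (w \<cdot> cox_gen i) = inv_number m w + 1 \<or>
      inv_number m w = inv_number m (w \<cdot> cox_gen i) + 1"
    using inv_number_ascent[OF assms] inv_number_descent[OF assms] inv_neq_succ[OF assms(1), of i]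
    by linarith
  ultimately show ?thesis using assms(1) by (simp only: cox_length_eq_inv_number)
qed

section \<open>Reduced words\<close>

lemma cox_length_id: "cox_length m id = 0"
  unfolding cox_length_def by (rule Least_eq_0) (auto simp: cox_word_def intro!: exI[of _ "[]"])

lemma cox_length_cox_word_le: "set is \<subseteq> {1..m} \<Longrightarrow> cox_length m (cox_word is) \<le> length is"
  unfolding cox_length_def by (rule Least_le) auto

lemma reduced_word_exists:
  assumes "w \<in> cox_group m"
  shows "\<exists>is. reduced_word m w is"
  using cox_word_of_inv_number[OF assms] cox_length_eq_inv_number[OF assms]
  by (auto simp: reduced_word_def)

text \<open>Dropping the last letter lowers the length of the element by at most 1, and the number
  of remaining letters bounds it from above; hence the shorter word is reduced too.\<close>

lemma reduced_word_snocD: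
  assumes "reduced_word m w (is @ [i])"
  shows "i \<in> {1..m}" "reduced_word m (cox_word is) is" "w = cox_word is \<cdot> cox_gen i"
    "cox_length m w = cox_length m (cox_word is) + 1"
proof -
  have *: "set is \<subseteq> {1..m}" "i \<in> {1..m}" "w = cox_word is \<cdot> cox_gen i"
    "cox_length m w = length is + 1"
    using assms by (auto simp: reduced_word_def cox_word_snoc)
  show "i \<in> {1..m}" "w = cox_word is \<cdot> cox_gen i" by fact+
  have le: "cox_length m (cox_word is) \<le> length is" using *(1) by (rule cox_length_cox_word_le)
  moreover have "cox_length m w \<le> cox_length m (cox_word is) + 1"
    using cox_length_pmult_cox_gen[OF cox_word_in_cox_group[OF *(1)] *(2)] *(3) by auto
  ultimately have "cox_length m (cox_word is) = length is" using *(4) by simp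
  then show "reduced_word m (cox_word is) is" "cox_length m w = cox_length m (cox_word is) + 1"
    using * by (auto simp: reduced_word_def)
qed

section \<open>Coset representatives of \<open>cox_group n\<close> in
  \<open>cox_group (Suc n)\<close>\<close>

lemma coset_rep_0: "coset_rep m 0 = id"
  by (simp add: coset_rep_def cox_word_def)

lemma coset_rep_Suc: "coset_rep m (Suc k) = coset_rep m k \<cdot> cox_gen (m - k)"
  by (simp add: coset_rep_def cox_word_snoc)

lemma coset_rep_in_cox_group: "k \<le> m \<Longrightarrow> coset_rep m k \<in> cox_group m"
  unfolding coset_rep_def by (rule cox_word_in_cox_group) auto

text \<open>Every letter moves the image of the last point \<open>n + 2\<close> down by one. Since
  \<open>cox_group n\<close> fixes this point, its image reveals which representative a product
  contains.\<close>

lemma coset_rep_last: "k \<le> Suc n \<Longrightarrow> coset_rep (Suc n) k (n + 2) = n + 2 - k"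
proof (induction k)
  case 0
  then show ?case by (simp add: coset_rep_0)
next
  case (Suc k)
  then show ?case by (simp add: coset_rep_Suc pmult_def) (simp add: cox_gen_def transpose_def)
qed

lemma cox_group_fixes_last: "u \<in> cox_group n \<Longrightarrow> u (n + 2) = n + 2"
  by (auto simp: cox_group_def intro: permutes_not_in)

lemma pmult_coset_rep_last:
  "u \<in> cox_group n \<Longrightarrow> k \<le> Suc n \<Longrightarrow> (u \<cdot> coset_rep (Suc n) k) (n + 2) = n + 2 - k"
  using cox_group_fixes_last[of u n] coset_rep_last[of k n] by (simp add: pmult_def)

lemma pmult_coset_rep_in_cox_group:
  "u \<in> cox_group n \<Longrightarrow> k \<le> Suc n \<Longrightarrow> u \<cdot> coset_rep (Suc n) k \<in> cox_group (Suc n)"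
  using cox_group_mono[of n "Suc n"] by (auto intro: pmult_in_cox_group coset_rep_in_cox_group)

text \<open>For \<open>w = u \<cdot> coset_rep (Suc n) k\<close> the largest value
  \<open>n + 2\<close> of \<open>inv w\<close> on \<open>{1..n+2}\<close> stands at position
  \<open>n + 2 - k\<close>. Its left neighbour is smaller, so the next letter
  \<open>cox_gen (n + 1 - k)\<close> is an ascent.\<close>

lemma pmult_coset_rep_ascent:
  assumes "u \<in> cox_group n" "Suc k \<le> Suc n" "Suc n \<le> m"
  shows "cox_length m (u \<cdot> coset_rep (Suc n) (Suc k)) = cox_length m (u \<cdot> coset_rep (Suc n) k) + 1"
proof -
  define w where "w = u \<cdot> coset_rep (Suc n) k"
  have w: "w permutes {1..n+2}" "w \<in> cox_group m"
    using pmult_coset_rep_in_cox_group[OF assms(1), of k] cox_group_mono[OF assms(3)] assms(2)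
    by (auto simp: w_def cox_group_def)
  have last: "inv w (n + 2 - k) = n + 2"
    using pmult_coset_rep_last[OF assms(1), of k] assms(2) w(1)
    by (metis permutes_inverses(2) Suc_leD w_def)
  have "inv w (n + 1 - k) \<in> {1..n+2}"
    using permutes_in_image[OF permutes_inv[OF w(1)], of "n + 1 - k"] assms(2) by auto
  moreover have "inv w (n + 1 - k) \<noteq> n + 2"
  proof
    assume "inv w (n + 1 - k) = n + 2"
    with last have "inv w (n + 1 - k) = inv w (n + 2 - k)" by simp
    then have "n + 1 - k = n + 2 - k"
      using permutes_inj[OF permutes_inv[OF w(1)]] by (rule injD[rotated])
    then show False using assms(2) by simp
  qed
  ultimately have "inv w (Suc n - k) < inv w (Suc n - k + 1)"
    using last assms(2) by (simp add: Suc_diff_le)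
  moreover have i: "Suc n - k \<in> {1..m}" using assms by auto
  ultimately show ?thesis
    using cox_length_ascent[OF w(2) i]
    by (simp add: coset_rep_Suc w_def pmult_assoc)
qed

lemma cox_length_pmult_coset_rep:
  assumes "u \<in> cox_group n" "k \<le> Suc n" "Suc n \<le> m"
  shows "cox_length m (u \<cdot> coset_rep (Suc n) k) = cox_length m u + k"
  using assms(2)
proof (induction k)
  case 0
  then show ?case by (simp add: coset_rep_0 pmult_def)
next
  case (Suc k)
  then show ?case using pmult_coset_rep_ascent[OF assms(1) Suc.prems assms(3)] by simp
qed

text \<open>The image of the last point determines \<open>k\<close>; the common representative is
  injective and can then be cancelled.\<close>

lemma pmult_coset_rep_inject:
  assumes "u \<in> cox_group n" "v \<in> cox_group n" "k \<le> Suc n" "l \<le> Suc n"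
    and "u \<cdot> coset_rep (Suc n) k = v \<cdot> coset_rep (Suc n) l"
  shows "u = v \<and> k = l"
proof -
  have "n + 2 - k = n + 2 - l"
    using pmult_coset_rep_last[OF assms(1,3)] pmult_coset_rep_last[OF assms(2,4)] assms(5) by simp
  with assms(3,4) have kl: "k = l" by simp
  have "inj (coset_rep (Suc n) k)"
    using coset_rep_in_cox_group[OF assms(3)] by (auto simp: cox_group_def permutes_inj)
  then show ?thesis using assms(5) kl by (simp add: pmult_def fun_eq_iff inj_eq)
qed

lemma pmult_coset_rep_surj:
  assumes "w \<in> cox_group (Suc n)"
  shows "\<exists>u\<in>cox_group n. \<exists>k\<le>Suc n. w = u \<cdot> coset_rep (Suc n) k"
proof -
  have w: "w permutes {1..n+2}" using assms by (simp add: cox_group_def)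
  \<comment> \<open>With this \<open>k\<close> the representative agrees with \<open>w\<close> at
    the last point, so \<open>inv a \<circ> w\<close> fixes that point and lies in
    \<open>cox_group n\<close>.\<close>
  define k where "k = n + 2 - w (n + 2)"
  define a where "a = coset_rep (Suc n) k"
  have wn: "1 \<le> w (n + 2)" "w (n + 2) \<le> n + 2" using permutes_in_image[OF w, of "n + 2"] by auto
  then have k: "k \<le> Suc n" by (simp add: k_def)
  have a: "a permutes {1..n+2}"
    using coset_rep_in_cox_group[OF k] by (simp add: a_def cox_group_def)
  have "a (n + 2) = w (n + 2)"
    using coset_rep_last[OF k] wn by (simp add: a_def k_def)
  then have fixed: "(inv a \<circ> w) (n + 2) = n + 2"
    using permutes_inverses(2)[OF a] by (metis comp_apply)
  have "inv a \<circ> w permutes {1..n+2}" using w a by (simp add: permutes_compose permutes_inv)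
  then have "inv a \<circ> w permutes {1..n+1}"
    by (rule permutes_superset) (use fixed in \<open>auto simp: not_le le_Suc_eq\<close>)
  moreover have "w = (inv a \<circ> w) \<cdot> a"
    using permutes_inverses(1)[OF a] by (auto simp: pmult_def fun_eq_iff)
  ultimately show ?thesis using k by (auto simp: cox_group_def a_def)
qed

lemma coset_decomposition_bij:
  "bij_betw (\<lambda>(k, u). u \<cdot> coset_rep (Suc n) k) ({..Suc n} \<times> cox_group n) (cox_group (Suc n))"
proof (rule bij_betw_imageI)
  show "inj_on (\<lambda>(k, u). u \<cdot> coset_rep (Suc n) k) ({..Suc n} \<times> cox_group n)"
    using pmult_coset_rep_inject by (auto simp: inj_on_def)
  show "(\<lambda>(k, u). u \<cdot> coset_rep (Suc n) k) ` ({..Suc n} \<times> cox_group n) = cox_group (Suc n)"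
    using pmult_coset_rep_surj pmult_coset_rep_in_cox_group by fastforce
qed

text \<open>In the coset decomposition the length grows by \<open>k\<close> with
  \<open>0 \<le> k \<le> n + 1\<close>, so the average length grows by \<open>(n + 1) / 2\<close>
  from \<open>n\<close> to \<open>Suc n\<close>. The factor 4 clears the denominator of the average
  \<open>n * (n + 1) / 4\<close>. Lengths are taken in the fixed group \<open>cox_group m\<close>,
  so that one function is summed throughout the induction.\<close>

lemma sum_cox_length:
  "n \<le> m \<Longrightarrow> 4 * (\<Sum>w\<in>cox_group n. cox_length m w) = n * (n + 1) * fact (n + 1)"
proof (induction n)
  case 0
  have "cox_group 0 = {id}" by (auto simp: cox_group_def)
  then show ?case by (simp only: sum.insert sum.empty finite.emptyI empty_iff not_False_eq_True cox_length_id, simp)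
next
  case (Suc n)
  define S where "S = (\<Sum>w\<in>cox_group n. cox_length m w)"
  have S: "4 * S = n * (n + 1) * fact (n + 1)" using Suc by (simp add: S_def)
  have "(\<Sum>w\<in>cox_group (Suc n). cox_length m w)
      = (\<Sum>(k, u)\<in>{..Suc n} \<times> cox_group n. cox_length m (u \<cdot> coset_rep (Suc n) k))"
    using sum.reindex_bij_betw[OF coset_decomposition_bij, of "cox_length m" n]
    by (simp add: case_prod_unfold)
  also have "\<dots> = (\<Sum>(k, u)\<in>{..Suc n} \<times> cox_group n. cox_length m u + k)"
    using Suc.prems by (intro sum.cong) (auto simp: cox_length_pmult_coset_rep)
  also have "\<dots> = (\<Sum>k\<le>Suc n. S + fact (n + 1) * k)"
    unfolding sum.cartesian_product[symmetric] S_def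
    by (simp only: sum.distrib sum_constant card_cox_group of_nat_id)
  also have "\<dots> = (n + 2) * S + fact (n + 1) * (\<Sum>k\<le>Suc n. k)"
    by (simp only: sum.distrib sum_distrib_left) simp
  finally have eq: "(\<Sum>w\<in>cox_group (Suc n). cox_length m w) = (n + 2) * S + fact (n + 1) * (\<Sum>k\<le>Suc n. k)" .
  have "2 * (\<Sum>k\<le>Suc n. k) = (n + 1) * (n + 2)"
    using double_gauss_sum[of "Suc n", where 'a = nat]
    by (simp add: atMost_atLeast0 algebra_simps)
  then have "4 * (\<Sum>w\<in>cox_group (Suc n). cox_length m w)
      = (n + 2) * (4 * S) + 2 * fact (n + 1) * ((n + 1) * (n + 2))"
    unfolding eq by algebra
  also have "\<dots> = Suc n * (Suc n + 1) * fact (Suc n + 1)"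
    unfolding S by (simp add: algebra_simps)
  finally show ?case .
qed

text \<open>Multiplication by a generator exchanges ascents and descents, so each is half of the group.\<close>

lemma card_descents:
  assumes "i \<in> {1..m}"
  shows "2 * card {w \<in> cox_group m. \<not> cox_length m (w \<cdot> cox_gen i) > cox_length m w} = fact (m + 1)"
proof -
  let ?A = "{w \<in> cox_group m. cox_length m (w \<cdot> cox_gen i) > cox_length m w}"
  let ?D = "{w \<in> cox_group m. \<not> cox_length m (w \<cdot> cox_gen i) > cox_length m w}"
  have cl: "w \<cdot> cox_gen i \<in> cox_group m" if "w \<in> cox_group m" for w
    using that assms by (simp add: pmult_in_cox_group cox_gen_in_cox_group)
  have "bij_betw (\<lambda>w. w \<cdot> cox_gen i) ?A ?D"
    by (rule bij_betw_byWitness[where f' = "\<lambda>w. w \<cdot> cox_gen i"])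
      (use cl cox_length_pmult_cox_gen[OF _ assms] in \<open>fastforce simp: pmult_cox_gen_cancel\<close>)+
  then have "card ?A = card ?D" by (rule bij_betw_same_card)
  moreover have "card (?A \<union> ?D) = card ?A + card ?D"
    by (rule card_Un_disjoint) (auto simp: finite_cox_group)
  moreover have "?A \<union> ?D = cox_group m" by auto
  ultimately show ?thesis by (simp add: card_cox_group)
qed

section \<open>Coefficients in the Iwahori--Hecke algebra\<close>

text \<open>The order in which \<open>scalars\<close> meets the leaves of a nested coefficient list:
  the index \<open>k\<close> of the representative is outermost, the order inside each coefficient
  is recursive.\<close>

fun group_list :: "nat \<Rightarrow> (nat \<Rightarrow> nat) list" where
  "group_list 0 = [id]"
| "group_list (Suc n) =
     concat (map (\<lambda>k. map (\<lambda>u. u \<cdot> coset_rep (Suc n) k) (group_list n)) [0..<n + 2])"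

lemma set_group_list: "set (group_list n) = cox_group n"
proof (induction n)
  case 0
  show ?case by (auto simp: cox_group_def)
next
  case (Suc n)
  have "set (group_list (Suc n)) = (\<Union>k<n + 2. (\<lambda>u. u \<cdot> coset_rep (Suc n) k) ` cox_group n)"
    by (simp add: Suc lessThan_atLeast0 del: upt_Suc)
  also have "\<dots> = (\<lambda>(k, u). u \<cdot> coset_rep (Suc n) k) ` ({..Suc n} \<times> cox_group n)"
    by force
  finally have "set (group_list (Suc n)) =
      (\<lambda>(k, u). u \<cdot> coset_rep (Suc n) k) ` ({..Suc n} \<times> cox_group n)" .
  then show ?case using coset_decomposition_bij[of n] by (simp add: bij_betw_def)
qed

lemma length_group_list: "length (group_list n) = fact (n + 1)"
  by (induction n) (simp_all add: length_concat o_def sum_list_triv algebra_simps)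

section \<open>Expansion of products in the basis\<close>

lemma hecke_T_in_hecke_elts: "w \<in> cox_group m \<Longrightarrow> hecke_T w \<in> hecke_elts m"
  by (auto simp: hecke_elts_def hecke_T_def)

lemma hecke_elts_mono: "n \<le> m \<Longrightarrow> hecke_elts n \<subseteq> hecke_elts m"
  using cox_group_mono by (fastforce simp: hecke_elts_def)

lemma zero_in_hecke_elts: "(\<lambda>w. 0) \<in> hecke_elts m"
  by (simp add: hecke_elts_def)

lemma scale_in_hecke_elts: "g \<in> hecke_elts m \<Longrightarrow> (\<lambda>w. c * g w) \<in> hecke_elts m"
  by (simp add: hecke_elts_def)

lemma sum_in_hecke_elts:
  "finite A \<Longrightarrow> (\<And>a. a \<in> A \<Longrightarrow> f a \<in> hecke_elts m) \<Longrightarrow> (\<lambda>w. \<Sum>a\<in>A. f a w) \<in> hecke_elts m"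
  by (simp add: hecke_elts_def)

lemma hecke_elts_expand:
  assumes "h \<in> hecke_elts m"
  shows "h = (\<lambda>w. \<Sum>v\<in>cox_group m. h v * hecke_T v w)"
proof
  fix w
  have "(\<Sum>v\<in>cox_group m. h v * hecke_T v w) = (\<Sum>v\<in>cox_group m. if w = v then h v else 0)"
    by (intro sum.cong) (auto simp: hecke_T_def)
  also have "\<dots> = h w"
    using assms by (auto simp: sum.delta' finite_cox_group hecke_elts_def)
  finally show "h w = (\<Sum>v\<in>cox_group m. h v * hecke_T v w)" ..
qed

context hecke_algebra
begin

lemma mul_zero_right: "g \<in> hecke_elts m \<Longrightarrow> mul g (\<lambda>w. 0) = (\<lambda>w. 0)"
  using mul_scale_right[of g "\<lambda>w. 0" 0] by (simp add: zero_in_hecke_elts)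

lemma mul_zero_left: "g \<in> hecke_elts m \<Longrightarrow> mul (\<lambda>w. 0) g = (\<lambda>w. 0)"
  using mul_scale_left[of "\<lambda>w. 0" g 0] by (simp add: zero_in_hecke_elts)

lemma mul_sum_right:
  assumes "g \<in> hecke_elts m" "finite A" "\<And>a. a \<in> A \<Longrightarrow> f a \<in> hecke_elts m"
  shows "mul g (\<lambda>w. \<Sum>a\<in>A. f a w) = (\<lambda>w. \<Sum>a\<in>A. mul g (f a) w)"
  using assms(2,3)
proof (induction A)
  case empty
  then show ?case by (simp add: mul_zero_right assms(1))
next
  case (insert a A)
  then show ?case by (simp add: mul_add_right assms(1) sum_in_hecke_elts)
qed

lemma mul_sum_left:
  assumes "g \<in> hecke_elts m" "finite A" "\<And>a. a \<in> A \<Longrightarrow> f a \<in> hecke_elts m"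
  shows "mul (\<lambda>w. \<Sum>a\<in>A. f a w) g = (\<lambda>w. \<Sum>a\<in>A. mul (f a) g w)"
  using assms(2,3)
proof (induction A)
  case empty
  then show ?case by (simp add: mul_zero_left assms(1))
next
  case (insert a A)
  then show ?case by (simp add: mul_add_left assms(1) sum_in_hecke_elts)
qed

lemma mul_expand_right:
  assumes "g \<in> hecke_elts m" "h \<in> hecke_elts m"
  shows "mul g h w = (\<Sum>v\<in>cox_group m. h v * mul g (hecke_T v) w)"
proof -
  have "mul g h = mul g (\<lambda>w. \<Sum>v\<in>cox_group m. h v * hecke_T v w)"
    using hecke_elts_expand[OF assms(2)] by simp
  also have "\<dots> = (\<lambda>w. \<Sum>v\<in>cox_group m. mul g (\<lambda>w. h v * hecke_T v w) w)"
    by (intro mul_sum_right) (auto simp: assms finite_cox_group scale_in_hecke_elts hecke_T_in_hecke_elts)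
  also have "\<dots> = (\<lambda>w. \<Sum>v\<in>cox_group m. h v * mul g (hecke_T v) w)"
    by (simp add: mul_scale_right assms hecke_T_in_hecke_elts)
  finally show ?thesis by simp
qed

lemma mul_expand_left:
  assumes "g \<in> hecke_elts m" "h \<in> hecke_elts m"
  shows "mul h g w = (\<Sum>v\<in>cox_group m. h v * mul (hecke_T v) g w)"
proof -
  have "mul h g = mul (\<lambda>w. \<Sum>v\<in>cox_group m. h v * hecke_T v w) g"
    using hecke_elts_expand[OF assms(2)] by simp
  also have "\<dots> = (\<lambda>w. \<Sum>v\<in>cox_group m. mul (\<lambda>w. h v * hecke_T v w) g w)"
    by (intro mul_sum_left) (auto simp: assms finite_cox_group scale_in_hecke_elts hecke_T_in_hecke_elts)
  also have "\<dots> = (\<lambda>w. \<Sum>v\<in>cox_group m. h v * mul (hecke_T v) g w)"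
    by (simp add: mul_scale_left assms hecke_T_in_hecke_elts)
  finally show ?thesis by simp
qed

text \<open>Only \<open>v = w\<close> and \<open>v = w \<cdot> cox_gen i\<close> can contribute to
  the coefficient at \<open>w\<close>, and exactly one of these two is an ascent for
  \<open>cox_gen i\<close>. The outcome is the rule by which \<open>simple_step\<close> computes its
  entries.\<close>

lemma mul_cox_gen:
  assumes z: "z \<in> hecke_elts m" and i: "i \<in> {1..m}" and w: "w \<in> cox_group m"
  shows "mul z (hecke_T (cox_gen i)) w =
    (if cox_length m (w \<cdot> cox_gen i) > cox_length m w then q * z (w \<cdot> cox_gen i)
     else z (w \<cdot> cox_gen i) + (q - 1) * z w)"
proof -
  let ?up = "\<lambda>v. cox_length m (v \<cdot> cox_gen i) > cox_length m v"
  have ws: "w \<cdot> cox_gen i \<in> cox_group m"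
    using w i by (simp add: pmult_in_cox_group cox_gen_in_cox_group)
  have up_ws: "?up (w \<cdot> cox_gen i) \<longleftrightarrow> \<not> ?up w"
    using cox_length_pmult_cox_gen[OF w i] by (auto simp: pmult_cox_gen_cancel)
  \<comment> \<open>Both rules for basis elements in one form, with one summand for each possible
    source of the coefficient, so that each of the two sums over \<open>v\<close> collapses to a
    single term.\<close>
  have split: "z v * mul (hecke_T v) (hecke_T (cox_gen i)) w =
      (if v = w \<cdot> cox_gen i then z v * (if ?up v then 1 else q) else 0) +
      (if v = w then (if ?up v then 0 else z v * (q - 1)) else 0)" if v: "v \<in> cox_group m" for v
  proof (cases "?up v")
    case True
    have "mul (hecke_T v) (hecke_T (cox_gen i)) w = (if v = w \<cdot> cox_gen i then 1 else 0)"
      using mul_T_up[OF v i True] by (simp only: hecke_T_def eq_pmult_cox_gen_iff[of w v])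
    then show ?thesis using True by (auto simp only: if_True mult_1_right mult_zero_right add_0_right split: if_splits)
  next
    case False
    then have "cox_length m (v \<cdot> cox_gen i) < cox_length m v"
      using cox_length_pmult_cox_gen[OF v i] by auto
    then have "mul (hecke_T v) (hecke_T (cox_gen i)) w =
        (q - 1) * hecke_T v w + q * hecke_T (v \<cdot> cox_gen i) w"
      by (rule mul_T_down[OF v i, THEN fun_cong])
    also have "hecke_T v w = (if v = w then 1 else 0)"
      by (auto simp: hecke_T_def)
    also have "hecke_T (v \<cdot> cox_gen i) w = (if v = w \<cdot> cox_gen i then 1 else 0)"
      by (simp only: hecke_T_def eq_pmult_cox_gen_iff[of w v])
    finally have eq: "mul (hecke_T v) (hecke_T (cox_gen i)) w =
        (q - 1) * (if v = w then 1 else 0) + q * (if v = w \<cdot> cox_gen i then 1 else 0)" .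
    have distr: "c * ((q - 1) * (if Q then 1 else 0) + q * (if P then 1 else 0)) =
        (if P then c * q else 0) + (if Q then c * (q - 1) else 0)"
      for c :: 'z and P Q
      by (cases P; cases Q) (simp_all only: if_True if_False mult_1_right mult_zero_right
        add_0_left add_0_right distrib_left add.commute)
    show ?thesis unfolding eq distr if_not_P[OF False] ..
  qed
  have "mul z (hecke_T (cox_gen i)) w =
      (\<Sum>v\<in>cox_group m. z v * mul (hecke_T v) (hecke_T (cox_gen i)) w)"
    by (intro mul_expand_left z hecke_T_in_hecke_elts cox_gen_in_cox_group i)
  also have "\<dots> = z (w \<cdot> cox_gen i) * (if ?up (w \<cdot> cox_gen i) then 1 else q) +
      (if ?up w then 0 else z w * (q - 1))"
    by (subst sum.cong[OF refl split], assumption)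
      (simp only: sum.distrib sum.delta[OF finite_cox_group] w ws if_True)
  also have "\<dots> = (if ?up w then q * z (w \<cdot> cox_gen i) else z (w \<cdot> cox_gen i) + (q - 1) * z w)"
    by (simp only: up_ws) (simp add: mult.commute)
  finally show ?thesis .
qed

section \<open>Nested coefficient lists as reordered simple lists\<close>

lemma mul_T_coset_rep:
  assumes u: "u \<in> cox_group n" and "k \<le> Suc n" and n: "Suc n \<le> m"
  shows "mul (hecke_T u) (hecke_T (coset_rep (Suc n) k)) = hecke_T (u \<cdot> coset_rep (Suc n) k)"
  using assms(2)
proof (induction k)
  case 0
  have "u \<in> cox_group m" using u n cox_group_mono[of n m] by auto
  moreover have "u \<cdot> id = u" by (simp add: pmult_def)
  ultimately show ?case
    by (simp only: coset_rep_0 mul_one_right[OF hecke_T_in_hecke_elts])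
next
  case (Suc k)
  let ?a = "coset_rep (Suc n) k" and ?s = "cox_gen (Suc n - k)"
  have um: "u \<in> cox_group m" using u n cox_group_mono[of n m] by auto
  have i: "Suc n - k \<in> {1..m}" using Suc.prems n by auto
  have a: "?a \<in> cox_group m"
    using coset_rep_in_cox_group[of k "Suc n"] cox_group_mono[OF n] Suc.prems by auto
  \<comment> \<open>Used twice: \<open>v = id\<close> factors the longer representative, and
    \<open>v = u\<close> evaluates the product after reassociation.\<close>
  have step: "mul (hecke_T (v \<cdot> ?a)) (hecke_T ?s) = hecke_T (v \<cdot> ?a \<cdot> ?s)" if v: "v \<in> cox_group n" for v
  proof (rule mul_T_up[OF _ i])
    show "v \<cdot> ?a \<in> cox_group m"
      using v n cox_group_mono[of n m] a by (auto intro: pmult_in_cox_group)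
    show "cox_length m (v \<cdot> ?a) < cox_length m (v \<cdot> ?a \<cdot> ?s)"
      using pmult_coset_rep_ascent[OF v Suc.prems n] by (simp add: coset_rep_Suc pmult_assoc)
  qed
  have "id \<cdot> ?a = ?a" by (simp add: pmult_def)
  then have Ta: "hecke_T (?a \<cdot> ?s) = mul (hecke_T ?a) (hecke_T ?s)"
    using step[OF id_in_cox_group] by simp
  have "mul (hecke_T u) (hecke_T (coset_rep (Suc n) (Suc k)))
      = mul (hecke_T u) (mul (hecke_T ?a) (hecke_T ?s))"
    by (simp add: coset_rep_Suc Ta)
  also have "\<dots> = mul (mul (hecke_T u) (hecke_T ?a)) (hecke_T ?s)"
    by (rule mul_assoc[symmetric]) (intro hecke_T_in_hecke_elts um a cox_gen_in_cox_group i)+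
  also have "\<dots> = hecke_T (u \<cdot> coset_rep (Suc n) (Suc k))"
    using Suc step[OF u] by (simp add: coset_rep_Suc pmult_assoc)
  finally show ?case .
qed

lemma mul_coset_rep:
  assumes g: "g \<in> hecke_elts n" and k: "k \<le> Suc n" and n: "Suc n \<le> m"
  shows "mul g (hecke_T (coset_rep (Suc n) k)) w =
    (\<Sum>u\<in>cox_group n. g u * hecke_T (u \<cdot> coset_rep (Suc n) k) w)"
proof -
  have sub: "cox_group n \<subseteq> cox_group m" using n by (intro cox_group_mono) simp
  have "hecke_elts n \<subseteq> hecke_elts m" using n by (intro hecke_elts_mono) simp
  moreover have a: "coset_rep (Suc n) k \<in> cox_group m"
    using coset_rep_in_cox_group[OF k] cox_group_mono[OF n] by auto
  ultimately have "mul g (hecke_T (coset_rep (Suc n) k)) w =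
      (\<Sum>u\<in>cox_group m. g u * mul (hecke_T u) (hecke_T (coset_rep (Suc n) k)) w)"
    using g by (intro mul_expand_left hecke_T_in_hecke_elts) auto
  also have "\<dots> = (\<Sum>u\<in>cox_group n. g u * mul (hecke_T u) (hecke_T (coset_rep (Suc n) k)) w)"
    using g by (intro sum.mono_neutral_right finite_cox_group sub) (auto simp: hecke_elts_def)
  also have "\<dots> = (\<Sum>u\<in>cox_group n. g u * hecke_T (u \<cdot> coset_rep (Suc n) k) w)"
    by (intro sum.cong refl) (simp add: mul_T_coset_rep k n)
  finally show ?thesis .
qed

text \<open>Products of basis elements with representatives are basis elements, and each element of
  \<open>cox_group (Suc n)\<close> comes from exactly one pair. The coefficients of \<open>h\<close>
  can therefore be read off without any ring operation.\<close>

lemma sum_mul_coset_rep: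
  assumes hs: "\<And>k. k \<le> Suc n \<Longrightarrow> hs k \<in> hecke_elts n" and n: "Suc n \<le> m"
  defines "h \<equiv> \<lambda>w. \<Sum>k\<le>Suc n. mul (hs k) (hecke_T (coset_rep (Suc n) k)) w"
  shows "h \<in> hecke_elts (Suc n)"
    and "\<And>u k. u \<in> cox_group n \<Longrightarrow> k \<le> Suc n \<Longrightarrow> h (u \<cdot> coset_rep (Suc n) k) = hs k u"
proof -
  have h: "h w = (\<Sum>(k, u)\<in>{..Suc n} \<times> cox_group n. hs k u * hecke_T (u \<cdot> coset_rep (Suc n) k) w)" for w
    unfolding h_def sum.cartesian_product[symmetric]
    by (intro sum.cong refl mul_coset_rep hs n) auto
  show "h \<in> hecke_elts (Suc n)"
    unfolding hecke_elts_def h using pmult_coset_rep_in_cox_group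
    by (fastforce simp: hecke_T_def intro!: sum.neutral)
  fix u k assume u: "u \<in> cox_group n" and k: "k \<le> Suc n"
  have "h (u \<cdot> coset_rep (Suc n) k) =
      (\<Sum>x\<in>{..Suc n} \<times> cox_group n. if (k, u) = x then hs k u else 0)"
    unfolding h
  proof (intro sum.cong refl, clarify)
    fix l v assume "l \<le> Suc n" "v \<in> cox_group n"
    then have "u \<cdot> coset_rep (Suc n) k = v \<cdot> coset_rep (Suc n) l \<longleftrightarrow> k = l \<and> u = v"
      using pmult_coset_rep_inject[OF u _ k] by blast
    then show "hs l v * hecke_T (v \<cdot> coset_rep (Suc n) l) (u \<cdot> coset_rep (Suc n) k) =
        (if (k, u) = (l, v) then hs k u else 0)"
      by (auto simp: hecke_T_def)
  qed
  then show "h (u \<cdot> coset_rep (Suc n) k) = hs k u"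
    using u k by (simp add: sum.delta' finite_cox_group)
qed

text \<open>All that is needed about the tree: its leaves are the simple coefficients in a fixed
  order, so converting between the two kinds of list is free.\<close>

lemma nested_listD:
  "nested_list mul n h t \<Longrightarrow> n \<le> m \<Longrightarrow> h \<in> hecke_elts n \<and> scalars t = map h (group_list n)"
proof (induction n arbitrary: h t)
  case 0
  then obtain z where "t = Scalar z" "h = (\<lambda>w. z * hecke_T id w)" by auto
  then show ?case
    using scale_in_hecke_elts[OF hecke_T_in_hecke_elts[OF id_in_cox_group]]
    by (auto simp: hecke_T_def)
next
  case (Suc n)
  from Suc.prems(1) obtain hs ts where t: "t = Coeffs ts" "length ts = n + 2"
    and hs: "\<And>k. k \<le> Suc n \<Longrightarrow> hs k \<in> hecke_elts n"
    and ts: "\<And>k. k \<le> Suc n \<Longrightarrow> nested_list mul n (hs k) (ts ! k)"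
    and h: "h = (\<lambda>w. \<Sum>k\<le>Suc n. mul (hs k) (hecke_T (coset_rep (Suc n) k)) w)"
    by (auto simp only: nested_list.simps)
  have sc: "scalars (ts ! k) = map (hs k) (group_list n)" if "k \<le> Suc n" for k
    using Suc.IH[OF ts[OF that]] Suc.prems(2) by simp
  have coeff: "h (u \<cdot> coset_rep (Suc n) k) = hs k u" if "u \<in> cox_group n" "k \<le> Suc n" for u k
    unfolding h by (rule sum_mul_coset_rep(2)[OF hs Suc.prems(2) that])
  have "map scalars ts = map (\<lambda>k. scalars (ts ! k)) [0..<n + 2]"
    using t(2) by (intro nth_equalityI) (simp_all del: upt_Suc)
  also have "\<dots> = map (\<lambda>k. map h (map (\<lambda>u. u \<cdot> coset_rep (Suc n) k) (group_list n))) [0..<n + 2]"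
    by (intro map_cong refl) (auto simp: sc coeff set_group_list)
  finally have "scalars t = map h (group_list (Suc n))"
    by (simp add: t map_concat o_def)
  moreover have "h \<in> hecke_elts (Suc n)"
    unfolding h by (rule sum_mul_coset_rep(1)[OF hs Suc.prems(2)])
  ultimately show ?case by simp
qed

lemma nested_list_exists: "h \<in> hecke_elts n \<Longrightarrow> n \<le> m \<Longrightarrow> \<exists>t. nested_list mul n h t"
proof (induction n arbitrary: h)
  case 0
  have "h = (\<lambda>w. h id * hecke_T id w)"
    using 0 by (auto simp: hecke_elts_def hecke_T_def cox_group_def)
  then show ?case by auto
next
  case (Suc n)
  \<comment> \<open>The coefficient at \<open>k\<close> is \<open>h\<close> on the coset of the
    \<open>k\<close>-th representative, cut off to 0 outside \<open>cox_group n\<close> so that it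
    lies in \<open>hecke_elts n\<close>.\<close>
  define hs where "hs k = (\<lambda>u. if u \<in> cox_group n then h (u \<cdot> coset_rep (Suc n) k) else 0)" for k
  have hs: "hs k \<in> hecke_elts n" for k by (simp add: hs_def hecke_elts_def)
  have "n \<le> m" using Suc.prems(2) by simp
  then have "\<exists>T. \<forall>k. nested_list mul n (hs k) (T k)"
    by (intro choice allI Suc.IH hs)
  then obtain T where T: "nested_list mul n (hs k) (T k)" for k by blast
  let ?g = "\<lambda>w. \<Sum>k\<le>Suc n. mul (hs k) (hecke_T (coset_rep (Suc n) k)) w"
  note g = sum_mul_coset_rep[of n hs, OF hs Suc.prems(2)]
  have "h w = ?g w" for w
  proof (cases "w \<in> cox_group (Suc n)")
    case True
    then obtain u k where "u \<in> cox_group n" "k \<le> Suc n" "w = u \<cdot> coset_rep (Suc n) k"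
      using pmult_coset_rep_surj by blast
    then show ?thesis using g(2)[of u k] by (simp add: hs_def)
  next
    case False
    then show ?thesis using g(1) Suc.prems(1) by (simp add: hecke_elts_def)
  qed
  then have "h = ?g" by (rule ext)
  moreover have "\<forall>k\<le>Suc n. hs k \<in> hecke_elts n \<and> nested_list mul n (hs k) (map T [0..<n + 2] ! k)"
    using hs T by (simp del: upt_Suc)
  moreover have "length (map T [0..<n + 2]) = n + 2" by simp
  ultimately have "nested_list mul (Suc n) h (Coeffs (map T [0..<n + 2]))"
    unfolding nested_list.simps by blast
  then show ?case by blast
qed

end

section \<open>The simple coefficient list algorithm\<close>

lemma snd_simple_step_le: "snd (simple_step m q z i) \<le> 2 * fact (m + 1)"
proof -
  have "snd (simple_step m q z i) \<le> (\<Sum>w\<in>cox_group m. 2)"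
    unfolding simple_step_def c_list_def snd_conv
    by (intro sum_mono) (simp add: c_mul_def c_add_def c_bind_def)
  then show ?thesis by (simp add: card_cox_group)
qed

lemma simple_word_append:
  "simple_word m q z (is @ js) = c_bind (simple_word m q z is) (\<lambda>z'. simple_word m q z' js)"
  by (induction "is" arbitrary: z) (simp_all add: c_bind_def c_return_def)

lemma snd_simple_word_le: "snd (simple_word m q z is) \<le> 2 * fact (m + 1) * length is"
proof (induction "is" arbitrary: z)
  case Nil
  show ?case by (simp add: c_return_def)
next
  case (Cons i "is")
  show ?case
    using snd_simple_step_le[of m q z i] Cons[of "fst (simple_step m q z i)"]
    by (simp add: c_bind_def algebra_simps)
qed

lemma snd_simple_term_le:
  "snd (simple_term m q z c is) \<le> fact (m + 1) + 2 * fact (m + 1) * length is"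
  using snd_simple_word_le[of m q "\<lambda>w. if w \<in> cox_group m then c * z w else 0" "is"]
  unfolding simple_term_def c_bind_def c_list_def c_mul_def fst_conv snd_conv
  by (simp add: card_cox_group)

text \<open>Each term is charged \<open>fact (m + 1)\<close> for the scaling and as much for one
  vector addition, besides the cost of its word. The last term is charged an addition that does not
  take place, which keeps the bound uniform.\<close>

lemma snd_simple_sum_le:
  "snd (simple_sum m q red z b vs) \<le>
     (\<Sum>v\<leftarrow>vs. 2 * fact (m + 1) + 2 * fact (m + 1) * length (red v))"
proof (induction m q red z b vs rule: simple_sum.induct)
  case (1 m q red z b)
  then show ?case by (simp add: c_return_def)
next
  case (2 m q red z b v)
  then show ?case using snd_simple_term_le[of m q z "b v" "red v"] by simp
next
  case (3 m q red z b v v' vs)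
  have "snd (simple_sum m q red z b (v' # vs)) \<le>
     (\<Sum>v\<leftarrow>v' # vs. 2 * fact (m + 1) + 2 * fact (m + 1) * length (red v))"
    using 3 by blast
  then show ?case using snd_simple_term_le[of m q z "b v" "red v"]
    by (simp add: c_bind_def c_list_def c_add_def card_cox_group)
qed

section \<open>Correctness of the simple coefficient list algorithm\<close>

context hecke_algebra
begin

lemma fst_simple_step:
  assumes "z \<in> hecke_elts m" "i \<in> {1..m}"
  shows "fst (simple_step m q z i) = mul z (hecke_T (cox_gen i))"
proof
  fix w
  have "mul z (hecke_T (cox_gen i)) \<in> hecke_elts m"
    by (intro mul_closed assms hecke_T_in_hecke_elts cox_gen_in_cox_group)
  then show "fst (simple_step m q z i) w = mul z (hecke_T (cox_gen i)) w"
    using mul_cox_gen[OF assms, of w]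
    by (simp add: simple_step_def c_list_def c_mul_def c_add_def c_bind_def hecke_elts_def)
qed

lemma mul_T_snoc:
  assumes "z \<in> hecke_elts m" "v \<in> cox_group m" "i \<in> {1..m}"
    "cox_length m (v \<cdot> cox_gen i) > cox_length m v"
  shows "mul z (hecke_T (v \<cdot> cox_gen i)) = mul (mul z (hecke_T v)) (hecke_T (cox_gen i))"
  using assms by (simp add: mul_assoc hecke_T_in_hecke_elts cox_gen_in_cox_group flip: mul_T_up)

text \<open>Prefixes of a reduced word are reduced and each letter is an ascent, so the successive
  factors multiply to \<open>hecke_T v\<close>. The induction therefore removes the last
  letter.\<close>

lemma fst_simple_word:
  assumes "z \<in> hecke_elts m"
  shows "reduced_word m v is \<Longrightarrow> fst (simple_word m q z is) = mul z (hecke_T v)"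
proof (induction "is" arbitrary: v rule: rev_induct)
  case Nil
  then have "v = id" by (simp add: reduced_word_def cox_word_Nil)
  then show ?case using assms by (simp only: simple_word.simps c_return_def fst_conv mul_one_right)
next
  case (snoc i "is")
  note r = reduced_word_snocD[OF snoc.prems]
  have v': "cox_word is \<in> cox_group m"
    using r(2) by (intro cox_word_in_cox_group) (simp add: reduced_word_def)
  have "fst (simple_word m q z (is @ [i])) = mul (mul z (hecke_T (cox_word is))) (hecke_T (cox_gen i))"
    using snoc.IH[OF r(2)] r(1) assms v'
    by (simp add: simple_word_append c_bind_def c_return_def fst_simple_step mul_closed
        hecke_T_in_hecke_elts)
  also have "\<dots> = mul z (hecke_T (cox_word is \<cdot> cox_gen i))"
    using r(3,4) by (intro mul_T_snoc[symmetric] assms v' r(1)) simp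
  finally show ?case using r(3) by simp
qed

lemma fst_simple_term:
  assumes "z \<in> hecke_elts m" "reduced_word m v is" "v \<in> cox_group m"
  shows "fst (simple_term m q z c is) = (\<lambda>w. c * mul z (hecke_T v) w)"
proof -
  have "(\<lambda>w. if w \<in> cox_group m then c * z w else 0) = (\<lambda>w. c * z w)"
    using assms(1) by (auto simp: hecke_elts_def)
  then have "fst (simple_term m q z c is) = fst (simple_word m q (\<lambda>w. c * z w) is)"
    unfolding simple_term_def c_bind_def c_list_def c_mul_def fst_conv by (rule arg_cong)
  also have "\<dots> = mul (\<lambda>w. c * z w) (hecke_T v)"
    by (intro fst_simple_word assms scale_in_hecke_elts)
  finally show ?thesis using assms by (simp add: mul_scale_left hecke_T_in_hecke_elts)
qed

lemma fst_simple_sum: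
  assumes z: "z \<in> hecke_elts m"
  shows "(\<And>v. v \<in> set vs \<Longrightarrow> v \<in> cox_group m \<and> reduced_word m v (red v)) \<Longrightarrow>
    fst (simple_sum m q red z b vs) = (\<lambda>w. \<Sum>v\<leftarrow>vs. b v * mul z (hecke_T v) w)"
proof (induction vs rule: induct_list012)
  case 1
  show ?case by (simp add: c_return_def)
next
  case (2 v)
  then show ?case using fst_simple_term[OF z, of v "red v"] by simp
next
  case (3 v v' vs)
  \<comment> \<open>\<open>c_list\<close> returns 0 outside \<open>cox_group m\<close>, so the sum
    has to be shown to vanish there as well.\<close>
  have "mul z (hecke_T u) \<in> hecke_elts m" if "u \<in> set (v # v' # vs)" for u
    using 3(3)[OF that] z by (intro mul_closed hecke_T_in_hecke_elts) auto
  then have zero: "mul z (hecke_T u) w = 0" if "w \<notin> cox_group m" "u \<in> set (v # v' # vs)" for u w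
    using that unfolding hecke_elts_def by blast
  have *: "(\<Sum>u\<leftarrow>v # v' # vs. b u * mul z (hecke_T u) w) = 0" if "w \<notin> cox_group m" for w
    by (rule sum_list_0[THEN trans[rotated]], rule arg_cong[of _ _ sum_list], rule map_cong[OF refl])
      (simp add: zero[OF that])
  have "fst (simple_sum m q red z b (v' # vs)) = (\<lambda>w. \<Sum>u\<leftarrow>v' # vs. b u * mul z (hecke_T u) w)"
    using 3 by simp
  moreover have "fst (simple_term m q z (b v) (red v)) = (\<lambda>w. b v * mul z (hecke_T v) w)"
    using 3 by (intro fst_simple_term z) simp_all
  ultimately show ?case
    using * by (auto simp: c_bind_def c_list_def c_add_def fun_eq_iff)
qed

lemma simple_sum_correct:
  assumes "h \<in> hecke_elts m" "h' \<in> hecke_elts m"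
    and "\<forall>v\<in>cox_group m. reduced_word m v (red v)" "distinct vs" "set vs = cox_group m"
  shows "fst (simple_sum m q red h h' vs) = mul h h'"
proof
  fix w
  have "fst (simple_sum m q red h h' vs) w = (\<Sum>v\<leftarrow>vs. h' v * mul h (hecke_T v) w)"
    using assms by (subst fst_simple_sum) simp_all
  then show "fst (simple_sum m q red h h' vs) w = mul h h' w"
    using assms by (simp add: sum_list_distinct_conv_sum_set mul_expand_right)
qed

end

text \<open>Scalings and additions account for two operations per pair of group elements, and the
  words for \<open>2 * fact (m + 1)\<close> times the sum of all lengths. Doubling the cost keeps
  the inequality in the natural numbers.\<close>

lemma simple_sum_cost:
  assumes "\<forall>v\<in>cox_group m. reduced_word m v (red v)" "distinct vs" "set vs = cox_group m"
  shows "2 * snd (simple_sum m q red z b vs) \<le> (m ^ 2 + m + 4) * (fact (m + 1)) ^ 2"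
proof -
  define M :: nat where "M = fact (m + 1)"
  have "snd (simple_sum m q red z b vs) \<le> (\<Sum>v\<leftarrow>vs. 2 * M + 2 * M * length (red v))"
    unfolding M_def by (rule snd_simple_sum_le)
  also have "\<dots> = (\<Sum>v\<in>cox_group m. 2 * M + 2 * M * cox_length m v)"
    using assms by (simp add: sum_list_distinct_conv_sum_set reduced_word_def)
  also have "\<dots> = M * (2 * M) + 2 * M * (\<Sum>v\<in>cox_group m. cox_length m v)"
    by (simp only: sum.distrib sum_constant card_cox_group M_def of_nat_id sum_distrib_left[symmetric])
  finally have "2 * snd (simple_sum m q red z b vs) \<le>
      4 * M ^ 2 + M * (4 * (\<Sum>v\<in>cox_group m. cox_length m v))"
    by (simp add: power2_eq_square algebra_simps)
  also have "\<dots> = 4 * M ^ 2 + M * (m * (m + 1) * M)"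
    by (simp only: sum_cox_length[OF order_refl] M_def)
  also have "\<dots> = (m ^ 2 + m + 4) * M ^ 2"
    by (simp add: power2_eq_square algebra_simps)
  finally show ?thesis unfolding M_def .
qed

section \<open>Straight-line programs\<close>

lemma length_fst_instrs_val: "length (fst (instrs_val q xs rs cs)) = length rs + length cs"
  by (induction cs arbitrary: rs) (simp_all add: c_return_def c_bind_def)

lemma snd_instrs_val: "snd (instrs_val q xs rs cs) = length cs"
proof (induction cs arbitrary: rs)
  case (Cons c cs)
  have "snd (instr_val q xs rs c) = 1"
    by (cases c) (simp_all add: c_add_def c_sub_def c_mul_def)
  then show ?case by (simp add: Cons c_bind_def)
qed (simp add: c_return_def)

lemma fst_instrs_val_snoc:
  "fst (instrs_val q xs rs (cs @ [c])) =
     fst (instrs_val q xs rs cs) @ [fst (instr_val q xs (fst (instrs_val q xs rs cs)) c)]"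
  by (induction cs arbitrary: rs) (simp_all add: c_return_def c_bind_def)

lemma operand_ok_mono: "operand_ok n j a \<Longrightarrow> j \<le> j' \<Longrightarrow> operand_ok n j' a"
  by (cases a) auto

lemma operand_val_append:
  "operand_ok n (length rs) a \<Longrightarrow> operand_val q xs (rs @ rs') a = operand_val q xs rs a"
  by (cases a) (auto simp: nth_append)

text \<open>\<open>computable q n D enc k F\<close>: one straight-line program of at most \<open>k\<close> instructions, run on the
  \<open>n\<close> scalars encoding an argument in \<open>D\<close>, has all functions in \<open>F\<close> among its intermediate values.\<close>

definition computable ::
  "'z::{comm_ring,monoid_mult} \<Rightarrow> nat \<Rightarrow> 'i set \<Rightarrow> ('i \<Rightarrow> 'z list) \<Rightarrow> nat \<Rightarrow> ('i \<Rightarrow> 'z) set \<Rightarrow> bool" where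
  "computable q n D enc k F \<longleftrightarrow>
     (\<exists>cs. length cs \<le> k \<and> (\<forall>j<length cs. instr_ok n j (cs ! j)) \<and>
       (\<forall>f\<in>F. \<exists>a. operand_ok n (length cs) a \<and>
          (\<forall>x\<in>D. operand_val q (enc x) (fst (instrs_val q (enc x) [] cs)) a = f x)))"

text \<open>Only values on \<open>D\<close> matter, so functions may be exchanged along identities
  that hold merely for elements of the algebra.\<close>

lemma computable_cong:
  assumes "computable q n D enc k F" "k \<le> k'" "\<And>f. f \<in> F' \<Longrightarrow> \<exists>g\<in>F. \<forall>x\<in>D. f x = g x"
  shows "computable q n D enc k' F'"
proof -
  from assms(1) obtain cs where cs: "length cs \<le> k" "\<forall>j<length cs. instr_ok n j (cs ! j)"
    "\<forall>f\<in>F. \<exists>a. operand_ok n (length cs) a \<and>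
      (\<forall>x\<in>D. operand_val q (enc x) (fst (instrs_val q (enc x) [] cs)) a = f x)"
    unfolding computable_def by blast
  have "\<exists>a. operand_ok n (length cs) a \<and>
      (\<forall>x\<in>D. operand_val q (enc x) (fst (instrs_val q (enc x) [] cs)) a = f x)" if "f \<in> F'" for f
    using assms(3)[OF that] cs(3) by fastforce
  then show ?thesis
    unfolding computable_def using cs(1,2) assms(2) by (intro exI[of _ cs]) auto
qed

lemma computable_mono:
  "computable q n D enc k F \<Longrightarrow> k \<le> k' \<Longrightarrow> F' \<subseteq> F \<Longrightarrow> computable q n D enc k' F'"
  by (erule computable_cong) auto

text \<open>One instruction is appended to the program; earlier results keep their positions, so
  every operand valid before keeps its value.\<close>

lemma computable_instr:
  assumes "computable q n D enc k F" "f \<in> F" "g \<in> F"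
    and ok: "\<And>j a b. operand_ok n j a \<Longrightarrow> operand_ok n j b \<Longrightarrow> instr_ok n j (I a b)"
    and val: "\<And>xs rs a b. fst (instr_val q xs rs (I a b)) =
      op (operand_val q xs rs a) (operand_val q xs rs b)"
  shows "computable q n D enc (k + 1) (insert (\<lambda>x. op (f x) (g x)) F)"
proof -
  from assms(1) obtain cs where len: "length cs \<le> k"
    and oks: "\<forall>j<length cs. instr_ok n j (cs ! j)"
    and F: "\<And>f. f \<in> F \<Longrightarrow> \<exists>a. operand_ok n (length cs) a \<and>
      (\<forall>x\<in>D. operand_val q (enc x) (fst (instrs_val q (enc x) [] cs)) a = f x)"
    unfolding computable_def by blast
  let ?rs = "\<lambda>x. fst (instrs_val q (enc x) [] cs)"
  have len_rs: "length (?rs x) = length cs" for x by (simp add: length_fst_instrs_val)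
  from F assms(2,3) obtain a b where a: "operand_ok n (length cs) a"
      "\<forall>x\<in>D. operand_val q (enc x) (?rs x) a = f x"
    and b: "operand_ok n (length cs) b" "\<forall>x\<in>D. operand_val q (enc x) (?rs x) b = g x"
    by meson
  define cs' where "cs' = cs @ [I a b]"
  have rs': "fst (instrs_val q (enc x) [] cs') =
      ?rs x @ [op (operand_val q (enc x) (?rs x) a) (operand_val q (enc x) (?rs x) b)]" for x
    by (simp add: cs'_def fst_instrs_val_snoc val)
  have "\<exists>c. operand_ok n (length cs') c \<and>
      (\<forall>x\<in>D. operand_val q (enc x) (fst (instrs_val q (enc x) [] cs')) c = e x)"
    if e: "e \<in> insert (\<lambda>x. op (f x) (g x)) F" for e
  proof (cases "e = (\<lambda>x. op (f x) (g x))")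
    case True
    \<comment> \<open>Results are numbered from 0, so the appended instruction has index
      \<open>length cs\<close>.\<close>
    then show ?thesis using a b
      by (intro exI[of _ "Result (length cs)"]) (simp add: rs' nth_append len_rs, simp add: cs'_def)
  next
    case False
    then obtain c where c: "operand_ok n (length cs) c" "\<forall>x\<in>D. operand_val q (enc x) (?rs x) c = e x"
      using F e by blast
    then have "operand_val q (enc x) (?rs x @ ys) c = operand_val q (enc x) (?rs x) c" for x ys
      by (intro operand_val_append[of n]) (simp add: len_rs)
    then have "\<forall>x\<in>D. operand_val q (enc x) (fst (instrs_val q (enc x) [] cs')) c = e x"
      using c(2) by (simp only: rs')
    moreover have "operand_ok n (length cs') c"
      using c(1) by (rule operand_ok_mono) (simp add: cs'_def)
    ultimately show ?thesis by blast
  qed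
  moreover have "\<forall>j<length cs'. instr_ok n j (cs' ! j)"
    using oks ok[OF a(1) b(1)] by (auto simp: cs'_def nth_append less_Suc_eq)
  moreover have "length cs' \<le> k + 1" using len by (simp add: cs'_def)
  ultimately show ?thesis unfolding computable_def by blast
qed

lemma computable_add:
  assumes "computable q n D enc k F" "f \<in> F" "g \<in> F"
  shows "computable q n D enc (k + 1) (insert (\<lambda>x. f x + g x) F)"
  by (rule computable_instr[OF assms, of Add "(+)"]) (simp_all add: c_add_def)

lemma computable_mult:
  assumes "computable q n D enc k F" "f \<in> F" "g \<in> F"
  shows "computable q n D enc (k + 1) (insert (\<lambda>x. f x * g x) F)"
  by (rule computable_instr[OF assms, of Mul "(*)"]) (simp_all add: c_mul_def)

text \<open>The step is required from every larger family \<open>F'\<close>, because the values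
  computed for other members of \<open>A\<close> stay available; the costs add up.\<close>

lemma computable_family:
  assumes "finite A" "computable q n D enc k F"
    and step: "\<And>a k F'. a \<in> A \<Longrightarrow> F \<subseteq> F' \<Longrightarrow> computable q n D enc k F' \<Longrightarrow>
      computable q n D enc (k + c) (F' \<union> G a)"
  shows "computable q n D enc (k + card A * c) (F \<union> (\<Union>a\<in>A. G a))"
  using assms(1) step
proof (induction A)
  case empty
  then show ?case using assms(2) by simp
next
  case (insert a A)
  have "computable q n D enc (k + card A * c) (F \<union> (\<Union>a\<in>A. G a))"
    using insert by blast
  from insert.prems[OF _ _ this, of a]
  have "computable q n D enc (k + card A * c + c) (F \<union> (\<Union>a\<in>A. G a) \<union> G a)"
    by blast
  then show ?case
    by (rule computable_mono) (use insert.hyps in auto)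
qed

lemma computable_add_family:
  assumes "finite A" "computable q n D enc k F" "\<And>a. a \<in> A \<Longrightarrow> f a \<in> F \<and> g a \<in> F"
  shows "computable q n D enc (k + card A) (F \<union> (\<lambda>a x. f a x + g a x) ` A)"
proof -
  have "computable q n D enc (k + card A * 1) (F \<union> (\<Union>a\<in>A. {\<lambda>x. f a x + g a x}))"
    by (rule computable_family[OF assms(1,2)]) (use assms(3) computable_add in fastforce)
  then show ?thesis by (rule computable_mono) auto
qed

lemma computable_mult_family:
  assumes "finite A" "computable q n D enc k F" "\<And>a. a \<in> A \<Longrightarrow> f a \<in> F \<and> g a \<in> F"
  shows "computable q n D enc (k + card A) (F \<union> (\<lambda>a x. f a x * g a x) ` A)"
proof -
  have "computable q n D enc (k + card A * 1) (F \<union> (\<Union>a\<in>A. {\<lambda>x. f a x * g a x}))"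
    by (rule computable_family[OF assms(1,2)]) (use assms(3) computable_mult in fastforce)
  then show ?thesis by (rule computable_mono) auto
qed

text \<open>The sums over all of \<open>B\<close> are built up together, one summand at a time. A
  single summand is already available, whereas the empty sum would call for a 0, which is not a free
  constant.\<close>

lemma computable_sum_family:
  assumes "computable q n D enc k F" "finite B" "finite A" "A \<noteq> {}"
    and "\<And>a b. a \<in> A \<Longrightarrow> b \<in> B \<Longrightarrow> f a b \<in> F"
  shows "computable q n D enc (k + card A * card B) (F \<union> (\<lambda>b x. \<Sum>a\<in>A. f a b x) ` B)"
  using assms(3-5)
proof (induction A rule: finite_ne_induct)
  case (singleton a)
  show ?case
    by (rule computable_mono[OF assms(1)]) (use singleton in auto)
next
  case (insert a A)
  let ?S = "\<lambda>b x. \<Sum>a\<in>A. f a b x"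
  have "computable q n D enc (k + card A * card B) (F \<union> ?S ` B)"
    using insert by blast
  from computable_add_family[OF assms(2) this, of "f a" ?S]
  have "computable q n D enc (k + card A * card B + card B)
      (F \<union> ?S ` B \<union> (\<lambda>b x. f a b x + ?S b x) ` B)"
    using insert.prems by blast
  then show ?case
    by (rule computable_mono) (use insert.hyps in auto)
qed

text \<open>Only the entries at descents need two operations.\<close>

lemma computable_cox_gen:
  assumes F: "computable q n D enc k F" and i: "i \<in> {1..m}"
    and q: "(\<lambda>_. q) \<in> F" "(\<lambda>_. q - 1) \<in> F" and V: "\<And>w. w \<in> cox_group m \<Longrightarrow> V w \<in> F"
    and c: "2 * c = 3 * fact (m + 1)"
  shows "computable q n D enc (k + c) (F \<union> (\<lambda>w x.
    if cox_length m (w \<cdot> cox_gen i) > cox_length m w then q * V (w \<cdot> cox_gen i) x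
    else V (w \<cdot> cox_gen i) x + (q - 1) * V w x) ` cox_group m)"
proof -
  let ?up = "\<lambda>w. cox_length m (w \<cdot> cox_gen i) > cox_length m w"
  let ?A = "{w \<in> cox_group m. ?up w}" and ?D = "{w \<in> cox_group m. \<not> ?up w}"
  have fin: "finite ?A" "finite ?D" by (simp_all add: finite_cox_group)
  have Vs: "V (w \<cdot> cox_gen i) \<in> F" if "w \<in> cox_group m" for w
    using that i by (intro V pmult_in_cox_group cox_gen_in_cox_group)
  have "card ?A + card ?D = card (cox_group m)"
    using fin by (subst card_Un_disjoint[symmetric]) (auto intro!: arg_cong[of _ _ card])
  \<comment> \<open>Ascents take one operation and descents two; each kind makes up half of the
    group, which gives three halves of its order.\<close>
  then have card: "card ?A + card ?D + card ?D = c"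
    using card_descents[OF i] c by (simp add: card_cox_group)
  let ?f = "\<lambda>w x. q * V (w \<cdot> cox_gen i) x" and ?g = "\<lambda>w x. (q - 1) * V w x"
  let ?g' = "\<lambda>w x. V (w \<cdot> cox_gen i) x + (q - 1) * V w x"
  have "computable q n D enc (k + card ?A) (F \<union> ?f ` ?A)"
    by (rule computable_mult_family[OF fin(1) F]) (use q Vs in auto)
  then have "computable q n D enc (k + card ?A + card ?D) (F \<union> ?f ` ?A \<union> ?g ` ?D)"
    by (rule computable_mult_family[OF fin(2)]) (use q V in auto)
  then have "computable q n D enc (k + card ?A + card ?D + card ?D)
      (F \<union> ?f ` ?A \<union> ?g ` ?D \<union> ?g' ` ?D)"
    by (rule computable_add_family[OF fin(2)]) (use Vs in auto)
  then show ?thesis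
  proof (rule computable_cong)
    fix e assume "e \<in> F \<union> (\<lambda>w x. if ?up w then ?f w x else ?g' w x) ` cox_group m"
    then consider "e \<in> F"
      | w where "w \<in> cox_group m" "e = (\<lambda>x. if ?up w then ?f w x else ?g' w x)"
      by blast
    then show "\<exists>g\<in>F \<union> ?f ` ?A \<union> ?g ` ?D \<union> ?g' ` ?D. \<forall>x\<in>D. e x = g x"
    proof cases
      case 1
      then show ?thesis by blast
    next
      case (2 w)
      then show ?thesis by (cases "?up w") auto
    qed
  qed (use card in simp)
qed

section \<open>A straight-line program for the product\<close>

context hecke_algebra
begin

text \<open>Layers of increasing length: a reduced word of \<open>v\<close> in layer
  \<open>Suc l\<close> ends in a generator that follows some \<open>u\<close> of length
  \<open>l\<close>, and the entries of the product with \<open>hecke_T u\<close> are already there.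
  So each \<open>v\<close> costs one multiplication by a generator.\<close>

lemma computable_mul_T:
  fixes enc :: "((nat \<Rightarrow> nat) \<Rightarrow> 'z) \<times> ((nat \<Rightarrow> nat) \<Rightarrow> 'z) \<Rightarrow> 'z list"
  defines "X \<equiv> \<lambda>v w (x :: ((nat \<Rightarrow> nat) \<Rightarrow> 'z) \<times> ((nat \<Rightarrow> nat) \<Rightarrow> 'z)). mul (fst x) (hecke_T v) w"
  assumes F: "computable q n (hecke_elts m \<times> hecke_elts m) enc 0 F"
    and q: "(\<lambda>_. q) \<in> F" "(\<lambda>_. q - 1) \<in> F" and id: "\<And>w. w \<in> cox_group m \<Longrightarrow> (\<lambda>x. fst x w) \<in> F"
    and c: "2 * c = 3 * fact (m + 1)"
  shows "computable q n (hecke_elts m \<times> hecke_elts m) enc (card {v \<in> cox_group m. cox_length m v \<le> l} * c)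
    (F \<union> (\<Union>v\<in>{v \<in> cox_group m. cox_length m v \<le> l}. X v ` cox_group m))"
proof (induction l)
  case 0
  \<comment> \<open>In layer 0 only \<open>id\<close> occurs, and the product with
    \<open>hecke_T id\<close> consists of inputs; no instruction is spent.\<close>
  have "\<exists>g\<in>F. \<forall>x\<in>hecke_elts m \<times> hecke_elts m. f x = g x"
    if f: "f \<in> F \<union> (\<Union>v\<in>{v \<in> cox_group m. cox_length m v \<le> 0}. X v ` cox_group m)" for f
  proof (cases "f \<in> F")
    case False
    then obtain v w where v: "v \<in> cox_group m" "cox_length m v = 0"
      and w: "w \<in> cox_group m" "f = X v w"
      using f by auto
    obtain "is" where "reduced_word m v is" using reduced_word_exists[OF v(1)] by blast
    with v(2) have "length is = 0" "cox_word is = v" unfolding reduced_word_def by auto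
    then have "v = id" by (simp only: length_0_conv cox_word_Nil)
    then have "\<forall>x\<in>hecke_elts m \<times> hecke_elts m. f x = fst x w"
      unfolding w(2) X_def using mul_one_right by auto
    then show ?thesis using id[OF w(1)] by (intro bexI)
  qed auto
  then show ?case by (rule computable_cong[OF F le0])
next
  case (Suc l)
  let ?D = "hecke_elts m \<times> hecke_elts m :: (((nat \<Rightarrow> nat) \<Rightarrow> 'z) \<times> ((nat \<Rightarrow> nat) \<Rightarrow> 'z)) set"
  let ?L = "{v \<in> cox_group m. cox_length m v \<le> l}" and ?A = "{v \<in> cox_group m. cox_length m v = Suc l}"
  let ?L' = "{v \<in> cox_group m. cox_length m v \<le> Suc l}"
  let ?F = "F \<union> (\<Union>v\<in>?L. X v ` cox_group m)"
  have fin: "finite ?L" "finite ?A" by (simp_all add: finite_cox_group)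
  have "computable q n ?D enc (card ?L * c + card ?A * c) (?F \<union> (\<Union>v\<in>?A. X v ` cox_group m))"
  proof (rule computable_family[OF fin(2) Suc])
    fix v k F' assume v: "v \<in> ?A" and F': "?F \<subseteq> F'" "computable q n ?D enc k F'"
    obtain "is" where "is": "reduced_word m v is" using reduced_word_exists v by blast
    have "is \<noteq> []" using v "is" by (auto simp: reduced_word_def)
    then obtain js i where "is = js @ [i]" using rev_exhaust by blast
    note r = reduced_word_snocD[OF "is"[unfolded this]]
    define u where "u = cox_word js"
    have u: "u \<in> cox_group m" unfolding u_def
      using r(2) by (intro cox_word_in_cox_group) (simp add: reduced_word_def)
    have "cox_length m u \<le> l" using r(4) v by (simp add: u_def)
    then have "X u w \<in> F'" if "w \<in> cox_group m" for w using u that F'(1) by blast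
    moreover have "(\<lambda>_. q) \<in> F'" "(\<lambda>_. q - 1) \<in> F'" using q F'(1) by auto
    ultimately have "computable q n ?D enc (k + c) (F' \<union> (\<lambda>w x.
        if cox_length m (w \<cdot> cox_gen i) > cox_length m w then q * X u (w \<cdot> cox_gen i) x
        else X u (w \<cdot> cox_gen i) x + (q - 1) * X u w x) ` cox_group m)"
      (is "computable _ _ _ _ _ (F' \<union> ?Y ` _)")
      by (intro computable_cox_gen F' r(1) c)
    moreover have "X v w x = ?Y w x" if "w \<in> cox_group m" "x \<in> ?D" for w x
    proof -
      have x: "fst x \<in> hecke_elts m" using that(2) by auto
      have "mul (fst x) (hecke_T v) = mul (mul (fst x) (hecke_T u)) (hecke_T (cox_gen i))"
        using mul_T_snoc[OF x u r(1)] r(3,4) by (simp add: u_def)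
      moreover have "mul (fst x) (hecke_T u) \<in> hecke_elts m"
        by (intro mul_closed x hecke_T_in_hecke_elts u)
      ultimately show ?thesis unfolding X_def using mul_cox_gen[OF _ r(1) that(1)] by simp
    qed
    ultimately show "computable q n ?D enc (k + c) (F' \<union> X v ` cox_group m)"
      by (elim computable_cong) auto
  qed
  moreover have L': "?L' = ?L \<union> ?A" by auto
  moreover have "card (?L \<union> ?A) = card ?L + card ?A"
    by (rule card_Un_disjoint) (use fin in auto)
  ultimately show ?case
    by (elim computable_mono) (auto simp only: L' distrib_right order_refl)
qed

text \<open>Expanding the second factor in the basis leaves, after the products with all
  \<open>hecke_T v\<close>, one scaling and at most one addition for each pair
  \<open>(v, w)\<close>; these are the two further contributions of \<open>fact (m + 1)\<close> per
  \<open>v\<close>.\<close>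

lemma computable_mul:
  fixes enc :: "((nat \<Rightarrow> nat) \<Rightarrow> 'z) \<times> ((nat \<Rightarrow> nat) \<Rightarrow> 'z) \<Rightarrow> 'z list"
  assumes F: "computable q n (hecke_elts m \<times> hecke_elts m) enc 0 F"
    and q: "(\<lambda>_. q) \<in> F" "(\<lambda>_. q - 1) \<in> F"
    and fst: "\<And>w. w \<in> cox_group m \<Longrightarrow> (\<lambda>x. fst x w) \<in> F"
    and snd: "\<And>w. w \<in> cox_group m \<Longrightarrow> (\<lambda>x. snd x w) \<in> F"
    and c: "2 * c = 3 * fact (m + 1)"
  shows "computable q n (hecke_elts m \<times> hecke_elts m) enc (fact (m + 1) * (c + 2 * fact (m + 1)))
    ((\<lambda>w x. mul (fst x) (snd x) w) ` cox_group m)"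
proof -
  let ?D = "hecke_elts m \<times> hecke_elts m :: (((nat \<Rightarrow> nat) \<Rightarrow> 'z) \<times> ((nat \<Rightarrow> nat) \<Rightarrow> 'z)) set"
  let ?W = "cox_group m" and ?M = "fact (m + 1) :: nat"
  let ?X = "\<lambda>v w (x :: ((nat \<Rightarrow> nat) \<Rightarrow> 'z) \<times> ((nat \<Rightarrow> nat) \<Rightarrow> 'z)). mul (fst x) (hecke_T v) w"
  let ?P = "\<lambda>v w x. snd x v * ?X v w x"
  have W: "finite ?W" "?W \<noteq> {}" "card ?W = ?M"
    using id_in_cox_group[of m] by (auto simp: finite_cox_group card_cox_group)
  \<comment> \<open>From this \<open>l\<close> on the layers exhaust the whole group.\<close>
  define l where "l = Max (cox_length m ` ?W)"
  have "{v \<in> ?W. cox_length m v \<le> l} = ?W"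
    using W by (auto simp: l_def)
  with computable_mul_T[OF F q fst c, of l]
  have "computable q n ?D enc (?M * c) (F \<union> (\<Union>v\<in>?W. ?X v ` ?W))" (is "computable _ _ _ _ _ ?F")
    by (simp only: W(3))
  then have prod: "computable q n ?D enc (?M * c + card (?W \<times> ?W))
      (?F \<union> (\<lambda>y x. snd x (fst y) * ?X (fst y) (snd y) x) ` (?W \<times> ?W))"
    (is "computable _ _ _ _ _ ?F'")
  proof (rule computable_mult_family[OF finite_cartesian_product[OF W(1) W(1)]])
    fix y assume "y \<in> ?W \<times> ?W"
    then have "fst y \<in> ?W" "snd y \<in> ?W" by auto
    then show "(\<lambda>x. snd x (fst y)) \<in> ?F \<and> ?X (fst y) (snd y) \<in> ?F"
      using snd by blast
  qed
  have "computable q n ?D enc (?M * c + card (?W \<times> ?W) + card ?W * card ?W)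
      (?F' \<union> (\<lambda>w x. \<Sum>v\<in>?W. ?P v w x) ` ?W)"
    by (rule computable_sum_family[OF prod W(1) W(1,2)]) (force simp: image_iff)
  then show ?thesis
  proof (rule computable_cong)
    show "?M * c + card (?W \<times> ?W) + card ?W * card ?W \<le> ?M * (c + 2 * ?M)"
      unfolding card_cartesian_product W(3) by (simp only: distrib_left mult_2 add.assoc order_refl)
    fix f assume "f \<in> (\<lambda>w x. mul (fst x) (snd x) w) ` ?W"
    then obtain w where w: "w \<in> ?W" "f = (\<lambda>x. mul (fst x) (snd x) w)" by blast
    show "\<exists>g\<in>?F' \<union> (\<lambda>w x. \<Sum>v\<in>?W. ?P v w x) ` ?W.
        \<forall>x\<in>?D. f x = g x"
      using w by (intro bexI[of _ "\<lambda>x. \<Sum>v\<in>?W. ?P v w x"]) (auto intro: mul_expand_right)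
  qed
qed

text \<open>One program serves all pairs of factors, because \<open>computable\<close> fixes the
  instructions before the argument is chosen. Inputs and outputs follow \<open>group_list m\<close>,
  the order of the leaves of nested lists.\<close>

lemma mul_slp_exists:
  assumes c: "2 * c = 3 * fact (m + 1)"
  shows "\<exists>P. slp_ok (2 * fact (m + 1)) P \<and> length (fst P) \<le> fact (m + 1) * (c + 2 * fact (m + 1)) \<and>
    (\<forall>h\<in>hecke_elts m. \<forall>h'\<in>hecke_elts m.
      fst (slp_val q P (map h (group_list m) @ map h' (group_list m))) = map (mul h h') (group_list m))"
proof -
  let ?L = "group_list m" and ?W = "cox_group m" and ?n = "2 * fact (m + 1) :: nat"
  define k where "k = fact (m + 1) * (c + 2 * fact (m + 1))"
  let ?D = "hecke_elts m \<times> hecke_elts m :: (((nat \<Rightarrow> nat) \<Rightarrow> 'z) \<times> ((nat \<Rightarrow> nat) \<Rightarrow> 'z)) set"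
  define enc where "enc = (\<lambda>(h, h'). map h ?L @ map h' ?L :: 'z list)"
  let ?F = "{\<lambda>_. q, \<lambda>_. q - 1} \<union> (\<lambda>w x. fst x w) ` ?W \<union> (\<lambda>w x. snd x w) ` ?W"
  have "computable q ?n ?D enc 0 ?F"
    unfolding computable_def
  proof (intro exI[of _ "[]"] conjI ballI)
    fix f assume "f \<in> ?F"
    then consider "f = (\<lambda>_. q)" | "f = (\<lambda>_. q - 1)"
      | w where "w \<in> ?W" "f = (\<lambda>x. fst x w)" | w where "w \<in> ?W" "f = (\<lambda>x. snd x w)"
      by blast
    then show "\<exists>a. operand_ok ?n (length []) a \<and>
        (\<forall>x\<in>?D. operand_val q (enc x) (fst (instrs_val q (enc x) [] [])) a = f x)"
    proof cases
      case 1
      then show ?thesis by (intro exI[of _ Const_q]) simp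
    next
      case 2
      then show ?thesis by (intro exI[of _ Const_q_minus_1]) simp
    next
      case (3 w)
      then obtain j where "j < length ?L" "?L ! j = w" by (metis in_set_conv_nth set_group_list)
      then show ?thesis using 3(2)
        by (intro exI[of _ "Input j"]) (auto simp: enc_def nth_append length_group_list)
    next
      case (4 w)
      then obtain j where "j < length ?L" "?L ! j = w" by (metis in_set_conv_nth set_group_list)
      \<comment> \<open>The coefficients of the second factor follow those of the first, hence the
        offset \<open>length ?L\<close>.\<close>
      then show ?thesis using 4(2)
        by (intro exI[of _ "Input (length ?L + j)"]) (auto simp: enc_def nth_append length_group_list)
    qed
  qed auto
  then have "computable q ?n ?D enc k ((\<lambda>w x. mul (fst x) (snd x) w) ` ?W)"
    unfolding k_def by (rule computable_mul[OF _ _ _ _ _ c]) auto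
  then obtain cs where cs: "length cs \<le> k" "\<forall>j<length cs. instr_ok ?n j (cs ! j)"
    and "\<forall>w\<in>?W. \<exists>a. operand_ok ?n (length cs) a \<and>
      (\<forall>x\<in>?D. operand_val q (enc x) (fst (instrs_val q (enc x) [] cs)) a = mul (fst x) (snd x) w)"
    unfolding computable_def by auto
  then obtain a where a: "\<And>w. w \<in> ?W \<Longrightarrow> operand_ok ?n (length cs) (a w)"
    "\<And>w x. w \<in> ?W \<Longrightarrow> x \<in> ?D \<Longrightarrow>
      operand_val q (enc x) (fst (instrs_val q (enc x) [] cs)) (a w) = mul (fst x) (snd x) w"
    by metis
  show ?thesis
    unfolding k_def[symmetric]
  proof (intro exI[of _ "(cs, map a ?L)"] conjI ballI)
    show "slp_ok ?n (cs, map a ?L)"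
      using cs(2) a(1) by (auto simp: slp_ok_def set_group_list)
    show "length (fst (cs, map a ?L)) \<le> k" using cs(1) by simp
    fix h h' :: "(nat \<Rightarrow> nat) \<Rightarrow> 'z" assume "h \<in> hecke_elts m" "h' \<in> hecke_elts m"
    then show "fst (slp_val q (cs, map a ?L) (map h ?L @ map h' ?L)) = map (mul h h') ?L"
      using a(2)[of _ "(h, h')"] by (simp add: slp_val_def c_bind_def c_return_def enc_def set_group_list)
  qed
qed

end

section \<open>Both cost bounds for multiplication in the Hecke algebra\<close>

theorem theorem1p1:
  fixes m :: nat
    and q :: "'z::{comm_ring,monoid_mult}"
    and mul :: "((nat \<Rightarrow> nat) \<Rightarrow> 'z) \<Rightarrow> ((nat \<Rightarrow> nat) \<Rightarrow> 'z) \<Rightarrow> ((nat \<Rightarrow> nat) \<Rightarrow> 'z)"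
    and M :: nat
  assumes "m \<ge> 1"
    and "hecke_algebra m q mul"
    and "M = fact (m + 1)"
  shows
    "(\<forall>red vs. \<forall>h \<in> hecke_elts m. \<forall>h' \<in> hecke_elts m.
        (\<forall>v \<in> cox_group m. reduced_word m v (red v)) \<and> distinct vs \<and> set vs = cox_group m \<longrightarrow>
          fst (simple_sum m q red h h' vs) = mul h h' \<and>
          real (snd (simple_sum m q red h h' vs)) \<le> (real m ^ 2 + real m + 4) / 2 * real M ^ 2)
     \<and>
     (\<exists>P. slp_ok (2 * M) P \<and>
        (\<forall>h \<in> hecke_elts m. \<forall>h' \<in> hecke_elts m. \<forall>t t'.
          nested_list mul m h t \<and> nested_list mul m h' t' \<longrightarrow>
            (\<exists>t''. nested_list mul m (mul h h') t'' \<and>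
              fst (slp_val q P (scalars t @ scalars t')) = scalars t'') \<and>
            real (snd (slp_val q P (scalars t @ scalars t'))) \<le> (1 + exp 1) * real M ^ 2))"
    (is "?A \<and> ?B")
proof
  interpret hecke_algebra m q mul by fact
  show ?A
  proof (intro allI ballI impI conjI)
    fix red vs and h h' :: "(nat \<Rightarrow> nat) \<Rightarrow> 'z"
    assume h: "h \<in> hecke_elts m" "h' \<in> hecke_elts m" and
      "(\<forall>v \<in> cox_group m. reduced_word m v (red v)) \<and> distinct vs \<and> set vs = cox_group m"
    then have vs: "\<forall>v \<in> cox_group m. reduced_word m v (red v)" "distinct vs" "set vs = cox_group m"
      by blast+
    show "fst (simple_sum m q red h h' vs) = mul h h'"
      by (rule simple_sum_correct[OF h vs])
    have "2 * snd (simple_sum m q red h h' vs) \<le> (m ^ 2 + m + 4) * M ^ 2"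
      using simple_sum_cost[OF vs] assms(3) by simp
    then have "real (2 * snd (simple_sum m q red h h' vs)) \<le> real ((m ^ 2 + m + 4) * M ^ 2)"
      by (rule of_nat_mono)
    then show "real (snd (simple_sum m q red h h' vs)) \<le> (real m ^ 2 + real m + 4) / 2 * real M ^ 2"
      by simp
  qed
  \<comment> \<open>Since \<open>m \<ge> 1\<close>, the group order is even and three halves of it
    is the natural number \<open>3 * d\<close>.\<close>
  have "2 dvd M" unfolding assms(3) using assms(1) by (intro dvd_fact) simp_all
  then obtain d where d: "M = 2 * d" by (rule dvdE)
  have "\<exists>P. slp_ok (2 * M) P \<and> length (fst P) \<le> M * (3 * d + 2 * M) \<and>
      (\<forall>h\<in>hecke_elts m. \<forall>h'\<in>hecke_elts m.
        fst (slp_val q P (map h (group_list m) @ map h' (group_list m))) = map (mul h h') (group_list m))"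
    unfolding assms(3) by (rule mul_slp_exists) (use d assms(3) in simp)
  then obtain P where P: "slp_ok (2 * M) P" "length (fst P) \<le> M * (3 * d + 2 * M)"
    "\<And>h h'. h \<in> hecke_elts m \<Longrightarrow> h' \<in> hecke_elts m \<Longrightarrow>
      fst (slp_val q P (map h (group_list m) @ map h' (group_list m))) = map (mul h h') (group_list m)"
    by blast
  have "real (length (fst P)) \<le> real (M * (3 * d + 2 * M))"
    using P(2) by (rule of_nat_mono)
  also have "\<dots> = 7 / 2 * real M ^ 2"
    by (simp add: d power2_eq_square)
  \<comment> \<open>The Taylor bound gives \<open>exp 1 \<ge> 1 + 1 + 1 / 2\<close>, so
    \<open>1 + exp 1\<close> is at least \<open>7 / 2\<close>.\<close>
  also have "\<dots> \<le> (1 + exp 1) * real M ^ 2"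
    using exp_lower_Taylor_quadratic[of "1 :: real"] by (intro mult_right_mono) simp_all
  finally have cost: "real (length (fst P)) \<le> (1 + exp 1) * real M ^ 2" .
  show ?B
  proof (intro exI[of _ P] conjI allI ballI impI)
    show "slp_ok (2 * M) P" by fact
    fix h h' :: "(nat \<Rightarrow> nat) \<Rightarrow> 'z" and t t'
    assume h: "h \<in> hecke_elts m" "h' \<in> hecke_elts m"
      and t: "nested_list mul m h t \<and> nested_list mul m h' t'"
    obtain t'' where t'': "nested_list mul m (mul h h') t''"
      using nested_list_exists[OF mul_closed[OF h]] by auto
    show "\<exists>t''. nested_list mul m (mul h h') t'' \<and>
        fst (slp_val q P (scalars t @ scalars t')) = scalars t''"
    proof (intro exI[of _ t''] conjI t'')
      have "scalars t = map h (group_list m)" "scalars t' = map h' (group_list m)"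
        "scalars t'' = map (mul h h') (group_list m)"
        using t t'' nested_listD[OF _ order_refl] by blast+
      then show "fst (slp_val q P (scalars t @ scalars t')) = scalars t''"
        by (simp only: P(3)[OF h])
    qed
    \<comment> \<open>Every instruction costs one unit and selecting the outputs is free, so the
      cost is the program length for all inputs.\<close>
    have "snd (slp_val q P (scalars t @ scalars t')) = length (fst P)"
      by (simp add: slp_val_def c_bind_def c_return_def snd_instrs_val)
    then show "real (snd (slp_val q P (scalars t @ scalars t'))) \<le> (1 + exp 1) * real M ^ 2"
      using cost by simp
  qed
qed

end
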